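(* Let $M=2^s m$ where $s\ge 2$ and $m\ge 1$ is odd. Suppose $a=\phi(b)>1$ for some positive integer $b$ which is neither a prime nor twice an odd prime. Then the arithmetic progression $a \pmod M$ contains infinitely many totients.
   Context: $\phi$ is Euler's function. A totient is a value $\phi(n)$ for some positive integer $n$. *)

theory Defs
  imports "HOL-Number_Theory.Number_Theory"
begin

definition is_totient :: "nat \<Rightarrow> bool" where
  "is_totient t \<longleftrightarrow> (\<exists>n>0. t = totient n)"

end

theory Submission
  imports Defs "HOL-Analysis.Infinite_Sum" "HOL-Analysis.Complex_Transcendental"
    "HOL-Analysis.Summation_Tests"
begin

text \<open>
  By Dirichlet's theorem on primes in arithmetic progressions, a prime factor of \<open>b\<close> may be
  replaced by arbitrarily large primes in any unit class modulo \<open>M\<close>, so it suffices to choose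
  the class such that the totient is unchanged modulo \<open>M\<close>.

  If \<open>b = p\<^sup>k c\<close> with \<open>k \<ge> 2\<close> and \<open>p\<close> coprime to \<open>c\<close>, one needs a unit \<open>x\<close> with
  \<open>x\<^sup>k\<^sup>-\<^sup>1 (x - 1) = p\<^sup>k\<^sup>-\<^sup>1 (p - 1)\<close> modulo \<open>M\<close>: away from \<open>p\<close> take \<open>x = p\<close>, and modulo powers of \<open>p\<close>
  solve for \<open>x\<close> congruent to \<open>1\<close> by Hensel lifting. If \<open>b\<close> is squarefree, it may be taken odd, and
  a factor \<open>3\<close> can be traded for \<open>4\<close>. There remain two distinct prime factors \<open>p, q \<ge> 5\<close>, and the
  Chinese remainder theorem gives units \<open>x, y\<close> with \<open>(x - 1) (y - 1) = (p - 1) (q - 1)\<close> modulo \<open>M\<close>.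

  Dirichlet's theorem itself is proved with series at real \<open>s > 1\<close> only. All estimates as
  \<open>s\<close> tends to \<open>1\<close> come from summation by parts. At most one nonprincipal \<open>L\<close>-series
  vanishes at \<open>1\<close>, since the product over all characters has nonnegative coefficients and is thus
  at least \<open>1\<close>; such a character would be real, which Monsky's Lambert series argument excludes.
\<close>

section \<open>Characters modulo \<open>N\<close>\<close>

text \<open>A prime factor \<open>p\<close> of \<open>b\<close> may divide \<open>M\<close>, and
  then Dirichlet's theorem does not reach the class of \<open>p\<close> itself: a unit class with
  the same effect on the totient has to be found. If \<open>p\<close> has exponent 1 and nothing
  else changes, \<open>x - 1 = p - 1\<close> modulo \<open>M\<close> forces \<open>x = p\<close>, so
  no such unit exists. A larger exponent or a second prime supplies the missing freedom, and the
  conditions on \<open>b\<close> guarantee one of the two once a single factor 2 is dropped through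
  \<open>totient (2 * c) = totient c\<close> for odd \<open>c\<close>.

  The link from L-series to primes is the logarithmic derivative, obtained algebraically: weighting
  coefficients by \<open>ln n\<close> is a derivation for Dirichlet convolution, and for a
  completely multiplicative \<open>c\<close> it amounts to convolving with
  \<open>c d * mangoldt d\<close>. No function of \<open>s\<close> is ever differentiated. Error
  bounds linear in \<open>s - 1\<close> take the place of analyticity; they are sharp enough to
  weigh zeros against the pole.\<close>

definition residue_char :: "nat \<Rightarrow> (nat \<Rightarrow> complex) \<Rightarrow> bool" where
  "residue_char N \<xi> \<longleftrightarrow>
     (\<forall>m n. [m = n] (mod N) \<longrightarrow> \<xi> m = \<xi> n) \<and>
     (\<forall>m n. \<xi> (m * n) = \<xi> m * \<xi> n) \<and>
     (\<forall>n. \<xi> n \<noteq> 0 \<longleftrightarrow> coprime n N)"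

definition principal_char :: "nat \<Rightarrow> nat \<Rightarrow> complex" where
  "principal_char N n = (if coprime n N then 1 else 0)"

text \<open>Subgroups of the unit group modulo \<open>N\<close> are represented by their full preimages in the
  natural numbers; closure under inverses is automatic because the group is finite.\<close>

definition unit_subgroup :: "nat \<Rightarrow> nat set \<Rightarrow> bool" where
  "unit_subgroup N H \<longleftrightarrow> 1 \<in> H \<and> (\<forall>n\<in>H. coprime n N) \<and>
     (\<forall>m\<in>H. \<forall>n\<in>H. m * n \<in> H) \<and> (\<forall>m\<in>H. \<forall>n. [m = n] (mod N) \<longrightarrow> n \<in> H)"

definition subgroup_char :: "nat \<Rightarrow> nat set \<Rightarrow> (nat \<Rightarrow> complex) \<Rightarrow> bool" where
  "subgroup_char N H \<psi> \<longleftrightarrow> \<psi> 1 = 1 \<and>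
     (\<forall>m\<in>H. \<forall>n\<in>H. \<psi> (m * n) = \<psi> m * \<psi> n) \<and>
     (\<forall>m\<in>H. \<forall>n\<in>H. [m = n] (mod N) \<longrightarrow> \<psi> m = \<psi> n)"

section \<open>Extending characters from subgroups of the unit group\<close>

lemma unit_subgroup_power:
  assumes "unit_subgroup N H" "h \<in> H"
  shows "h ^ k \<in> H"
  using assms by (induction k) (auto simp: unit_subgroup_def)

text \<open>By Euler's theorem \<open>h ^ (totient N - 1)\<close> is an inverse of \<open>h\<close>
  modulo \<open>N\<close>, and as a power of \<open>h\<close> it lies in \<open>H\<close>.\<close>

lemma unit_subgroup_cancel:
  assumes H: "unit_subgroup N H" and h: "h \<in> H" and "h * n \<in> H"
  shows "n \<in> H"
proof -
  have cop: "coprime h N" using H h by (auto simp: unit_subgroup_def)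
  have "h ^ (totient N - 1) * (h * n) \<in> H"
    using assms unit_subgroup_power[OF H h] by (auto simp: unit_subgroup_def)
  moreover have "[h ^ (totient N - 1) * (h * n) = n] (mod N)"
  proof (cases "N = 0")
    case True
    thus ?thesis using cop by simp
  next
    case False
    hence "h ^ (totient N - 1) * (h * n) = h ^ totient N * n"
      by (metis totient_gt_0_iff neq0_conv power_minus_mult mult.assoc)
    also have "[h ^ totient N * n = 1 * n] (mod N)"
      by (intro cong_mult cong_refl euler_theorem cop)
    finally show ?thesis by simp
  qed
  ultimately show ?thesis using H unfolding unit_subgroup_def by blast
qed

lemma
  assumes "subgroup_char N H \<psi>"
  shows subgroup_char_1: "\<psi> 1 = 1"
    and subgroup_char_mult: "m \<in> H \<Longrightarrow> n \<in> H \<Longrightarrow> \<psi> (m * n) = \<psi> m * \<psi> n"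
    and subgroup_char_cong: "m \<in> H \<Longrightarrow> n \<in> H \<Longrightarrow> [m = n] (mod N) \<Longrightarrow> \<psi> m = \<psi> n"
  using assms unfolding subgroup_char_def by blast+

lemma subgroup_char_power:
  assumes "unit_subgroup N H" "subgroup_char N H \<psi>" "h \<in> H"
  shows "\<psi> (h ^ k) = \<psi> h ^ k"
proof (induction k)
  case 0
  show ?case using subgroup_char_1[OF assms(2)] by simp
next
  case (Suc k)
  have "h ^ k \<in> H" using assms unit_subgroup_power by blast
  thus ?case using subgroup_char_mult[OF assms(2)] assms(3) Suc by simp
qed

text \<open>The enlarged group consists of the classes of \<open>h * g ^ i\<close>, with value
  \<open>\<psi> h * z ^ i\<close>. Minimality of \<open>d\<close> means that a power of
  \<open>g\<close> falls into \<open>H\<close> only if its exponent is a multiple of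
  \<open>d\<close>, so the single equation \<open>z ^ d = \<psi> (g ^ d)\<close> makes this value
  independent of the representation.\<close>

lemma subgroup_char_extend_step:
  assumes H: "unit_subgroup N H" and \<psi>: "subgroup_char N H \<psi>"
    and g: "coprime g N" and d: "d > 0" "g ^ d \<in> H" "\<And>i. 0 < i \<Longrightarrow> i < d \<Longrightarrow> g ^ i \<notin> H"
    and z: "z ^ d = \<psi> (g ^ d)"
  obtains H' \<psi>' where "unit_subgroup N H'" "subgroup_char N H' \<psi>'" "H \<subseteq> H'" "g \<in> H'"
    "\<And>h. h \<in> H \<Longrightarrow> \<psi>' h = \<psi> h" "\<psi>' g = z"
proof -
  have H1: "1 \<in> H" and Hc: "\<And>n. n \<in> H \<Longrightarrow> coprime n N"
    and Hm: "\<And>m n. m \<in> H \<Longrightarrow> n \<in> H \<Longrightarrow> m * n \<in> H"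
    and Hcong: "\<And>m n. m \<in> H \<Longrightarrow> [m = n] (mod N) \<Longrightarrow> n \<in> H"
    using H unfolding unit_subgroup_def by blast+
  note p1 = subgroup_char_1[OF \<psi>] and pm = subgroup_char_mult[OF \<psi>] and pc = subgroup_char_cong[OF \<psi>]
  have wd: "\<psi> h * z ^ i = \<psi> h' * z ^ j"
    if hh: "h \<in> H" "h' \<in> H" "[h * g ^ i = h' * g ^ j] (mod N)" "j \<le> i" for h h' i j
  proof -
    define k where "k = i - j"
    have ik: "i = k + j" using hh(4) by (simp add: k_def)
    have "[h * g ^ k * g ^ j = h' * g ^ j] (mod N)"
      using hh(3) by (simp add: ik power_add mult.assoc)
    hence hk: "[h * g ^ k = h'] (mod N)"
      using g by (subst (asm) cong_mult_rcancel_nat) simp_all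
    hence hgk: "h * g ^ k \<in> H" using hh(2) Hcong cong_sym by blast
    hence gk: "g ^ k \<in> H" using unit_subgroup_cancel[OF H hh(1)] by blast
    \<comment> \<open>Cancelling the part already in \<open>H\<close> leaves the exponent
      \<open>k mod d < d\<close>, which minimality of \<open>d\<close> forces to be 0.\<close>
    have "(g ^ d) ^ (k div d) * g ^ (k mod d) = g ^ k"
      by (simp flip: power_mult power_add)
    hence "g ^ (k mod d) \<in> H"
      using unit_subgroup_cancel[OF H unit_subgroup_power[OF H d(2)]] gk by metis
    hence "k mod d = 0" using d(1) d(3)[of "k mod d"] by (cases "k mod d = 0") auto
    then obtain q where q: "k = d * q" by auto
    have "\<psi> h' = \<psi> (h * g ^ k)" using pc hgk hh(2) hk by metis
    also have "\<dots> = \<psi> h * \<psi> (g ^ k)" using pm hh(1) gk by simp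
    also have "\<psi> (g ^ k) = z ^ k"
      using subgroup_char_power[OF H \<psi> d(2), of q] z by (simp add: q power_mult)
    finally show ?thesis by (simp add: ik power_add mult.assoc)
  qed
  have wd': "\<psi> h * z ^ i = \<psi> h' * z ^ j"
    if hh: "h \<in> H" "h' \<in> H" "[h * g ^ i = h' * g ^ j] (mod N)" for h h' i j
    using wd[of h h' i j] wd[of h' h j i] hh cong_sym[OF hh(3)] by (cases "j \<le> i") auto
  define H' where "H' = {n. \<exists>h\<in>H. \<exists>i. [n = h * g ^ i] (mod N)}"
  define \<psi>' where "\<psi>' n = (SOME w. \<exists>h\<in>H. \<exists>i. [n = h * g ^ i] (mod N) \<and> w = \<psi> h * z ^ i)" for n
  have ev: "\<psi>' n = \<psi> h * z ^ i" if "h \<in> H" "[n = h * g ^ i] (mod N)" for n h i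
  proof -
    have "\<exists>h\<in>H. \<exists>i. [n = h * g ^ i] (mod N) \<and> \<psi>' n = \<psi> h * z ^ i"
      unfolding \<psi>'_def by (rule someI_ex) (use that in blast)
    then obtain h' j where hj: "h' \<in> H" "[n = h' * g ^ j] (mod N)" "\<psi>' n = \<psi> h' * z ^ j" by blast
    thus ?thesis using wd'[OF hj(1) that(1)] that(2) cong_sym cong_trans by metis
  qed
  have mulrep: "[m * n = (h * h') * g ^ (i + j)] (mod N)"
    if "[m = h * g ^ i] (mod N)" "[n = h' * g ^ j] (mod N)" for m n h h' i j
    using cong_mult[OF that] by (simp add: power_add mult_ac)
  have "unit_subgroup N H'"
    unfolding unit_subgroup_def
  proof (intro conjI ballI allI impI)
    show "1 \<in> H'" unfolding H'_def using H1 by (auto intro!: bexI[of _ 1] exI[of _ 0])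
    show "coprime n N" if "n \<in> H'" for n
    proof -
      obtain h i where "h \<in> H" "[n = h * g ^ i] (mod N)" using \<open>n \<in> H'\<close> by (auto simp: H'_def)
      moreover have "coprime (h * g ^ i) N" using Hc[OF \<open>h \<in> H\<close>] g by simp
      ultimately show ?thesis using cong_imp_coprime cong_sym by blast
    qed
    show "m * n \<in> H'" if mn: "m \<in> H'" "n \<in> H'" for m n
    proof -
      obtain h i h' j where "h \<in> H" "[m = h * g ^ i] (mod N)" "h' \<in> H" "[n = h' * g ^ j] (mod N)"
        using mn by (auto simp: H'_def)
      thus ?thesis unfolding H'_def using Hm mulrep by blast
    qed
    show "n \<in> H'" if mn: "m \<in> H'" "[m = n] (mod N)" for m n
      using mn unfolding H'_def using cong_sym cong_trans by blast
  qed
  moreover have "subgroup_char N H' \<psi>'"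
    unfolding subgroup_char_def
  proof (intro conjI ballI allI impI)
    show "\<psi>' 1 = 1" using ev[OF H1, of 1 0] p1 by simp
    show "\<psi>' (m * n) = \<psi>' m * \<psi>' n" if mn: "m \<in> H'" "n \<in> H'" for m n
    proof -
      obtain h i h' j where hh: "h \<in> H" "[m = h * g ^ i] (mod N)" "h' \<in> H" "[n = h' * g ^ j] (mod N)"
        using mn by (auto simp: H'_def)
      have "\<psi>' (m * n) = \<psi> (h * h') * z ^ (i + j)"
        using ev[OF Hm[OF hh(1,3)] mulrep[OF hh(2,4)]] .
      thus ?thesis using ev[OF hh(1,2)] ev[OF hh(3,4)] pm[OF hh(1,3)]
        by (simp add: power_add mult_ac)
    qed
    show "\<psi>' m = \<psi>' n" if mn: "m \<in> H'" "n \<in> H'" "[m = n] (mod N)" for m n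
    proof -
      obtain h i where hh: "h \<in> H" "[m = h * g ^ i] (mod N)" using mn by (auto simp: H'_def)
      moreover have "[n = h * g ^ i] (mod N)" using hh(2) mn(3) cong_sym cong_trans by blast
      ultimately show ?thesis using ev by metis
    qed
  qed
  moreover have "H \<subseteq> H'"
    unfolding H'_def by (auto intro!: exI[of _ 0] bexI)
  moreover have "g \<in> H'"
    unfolding H'_def using H1 by (auto intro!: exI[of _ 1] bexI[of _ 1])
  moreover have "\<psi>' h = \<psi> h" if "h \<in> H" for h
    using ev[OF that, of h 0] by simp
  moreover have "\<psi>' g = z"
    using ev[OF H1, of g 1] p1 by simp
  ultimately show ?thesis using that by blast
qed

lemma exists_least_power_in_unit_subgroup:
  assumes "unit_subgroup N H" "coprime g N" "N > 0"
  obtains d where "d > 0" "g ^ d \<in> H" "\<And>i. 0 < i \<Longrightarrow> i < d \<Longrightarrow> g ^ i \<notin> H"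
proof -
  have "g ^ totient N \<in> H"
    using euler_theorem[OF assms(2)] assms(1) cong_sym unfolding unit_subgroup_def by blast
  hence ex: "\<exists>d. d > 0 \<and> g ^ d \<in> H" using assms(3) totient_gt_0_iff by blast
  define d where "d = (LEAST d. d > 0 \<and> g ^ d \<in> H)"
  have "d > 0 \<and> g ^ d \<in> H" unfolding d_def by (rule LeastI_ex[OF ex])
  moreover have "g ^ i \<notin> H" if "0 < i" "i < d" for i
    using not_less_Least[of i "\<lambda>d. d > 0 \<and> g ^ d \<in> H"] that unfolding d_def by blast
  ultimately show ?thesis using that by blast
qed

text \<open>Adjoins one missing unit at a time; complex roots always exist, so a value
  \<open>z\<close> for the new generator can be chosen. Once \<open>H\<close> contains all units,
  extension by zero gives the character, and its values on units are nonzero because their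
  \<open>totient N\<close>-th power is 1.\<close>

lemma subgroup_char_extend:
  assumes N: "N > 0" and H: "unit_subgroup N H" and \<psi>: "subgroup_char N H \<psi>"
  shows "\<exists>\<xi>. residue_char N \<xi> \<and> (\<forall>h\<in>H. \<xi> h = \<psi> h)"
  using H \<psi>
proof (induction "N - card (H \<inter> {..<N})" arbitrary: H \<psi> rule: less_induct)
  case less
  note H = less.prems(1) and \<psi> = less.prems(2)
  show ?case
  proof (cases "\<exists>g. coprime g N \<and> g \<notin> H")
    case False
    hence HH: "n \<in> H \<longleftrightarrow> coprime n N" for n using H unfolding unit_subgroup_def by blast
    define \<xi> where "\<xi> n = (if coprime n N then \<psi> n else 0)" for n
    have nz: "\<psi> n \<noteq> 0" if "coprime n N" for n
    proof -
      have "\<psi> n ^ totient N = \<psi> (n ^ totient N)"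
        using subgroup_char_power[OF H \<psi>] that HH by metis
      also have "\<dots> = \<psi> 1"
        using HH euler_theorem[OF that] that by (intro subgroup_char_cong[OF \<psi>]) auto
      also have "\<dots> = 1" by (rule subgroup_char_1[OF \<psi>])
      finally show ?thesis using N by (auto simp: power_0_left)
    qed
    have "residue_char N \<xi>"
      unfolding residue_char_def
    proof (intro conjI allI impI)
      show "\<xi> m = \<xi> n" if "[m = n] (mod N)" for m n
      proof -
        have "coprime m N \<longleftrightarrow> coprime n N" using that by (rule coprime_cong_cong_left)
        thus ?thesis using subgroup_char_cong[OF \<psi> _ _ that] unfolding \<xi>_def HH by auto
      qed
      show "\<xi> (m * n) = \<xi> m * \<xi> n" for m n
        using subgroup_char_mult[OF \<psi>] unfolding \<xi>_def HH by auto
      show "\<xi> n \<noteq> 0 \<longleftrightarrow> coprime n N" for n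
        using nz by (simp add: \<xi>_def)
    qed
    moreover have "\<forall>h\<in>H. \<xi> h = \<psi> h" by (simp add: \<xi>_def HH)
    ultimately show ?thesis by blast
  next
    case True
    then obtain g where g: "coprime g N" "g \<notin> H" by blast
    obtain d where d: "d > 0" "g ^ d \<in> H" "\<And>i. 0 < i \<Longrightarrow> i < d \<Longrightarrow> g ^ i \<notin> H"
      using exists_least_power_in_unit_subgroup[OF H g(1) N] by blast
    have "d \<noteq> 0" using d(1) by simp
    then obtain z where z: "\<psi> (g ^ d) = z ^ d"
      by (rule exists_complex_root)
    obtain H' \<psi>' where H': "unit_subgroup N H'" "subgroup_char N H' \<psi>'" "H \<subseteq> H'" "g \<in> H'"
      "\<And>h. h \<in> H \<Longrightarrow> \<psi>' h = \<psi> h"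
      using subgroup_char_extend_step[OF H \<psi> g(1) d z[symmetric]] by blast
    \<comment> \<open>The measure counts only elements below \<open>N\<close>, and \<open>g\<close>
      may be larger; its residue witnesses that the count grows.\<close>
    have "[g mod N = g] (mod N)" by simp
    hence "g mod N \<in> H'" "g mod N \<notin> H"
      using H'(1,4) H g(2) cong_sym unfolding unit_subgroup_def by blast+
    hence "H \<inter> {..<N} \<subset> H' \<inter> {..<N}" using H'(3) N by auto
    hence "card (H \<inter> {..<N}) < card (H' \<inter> {..<N})" by (intro psubset_card_mono) auto
    moreover have "card (H' \<inter> {..<N}) \<le> N"
      using card_mono[of "{..<N}" "H' \<inter> {..<N}"] by simp
    ultimately have "N - card (H' \<inter> {..<N}) < N - card (H \<inter> {..<N})" by linarith
    then obtain \<xi> where "residue_char N \<xi>" "\<forall>h\<in>H'. \<xi> h = \<psi>' h"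
      using less.hyps H'(1,2) by blast
    thus ?thesis using H'(3,5) by (metis subsetD)
  qed
qed

text \<open>Starts from the trivial subgroup, where \<open>d\<close> is the order of
  \<open>a\<close> modulo \<open>N\<close>. As \<open>d > 1\<close>, a primitive \<open>d\<close>-th
  root of unity is an admissible value at \<open>a\<close> different from 1.\<close>

lemma exists_residue_char_neq_1:
  assumes N: "N > 0" and a: "coprime a N" "\<not> [a = 1] (mod N)"
  shows "\<exists>\<xi>. residue_char N \<xi> \<and> \<xi> a \<noteq> 1"
proof -
  define H where "H = {n. [n = 1] (mod N)}"
  have H: "unit_subgroup N H"
    unfolding unit_subgroup_def H_def
    using cong_mult[of _ 1 N _ 1] cong_imp_coprime[of 1 _ N]
    by (auto intro: cong_sym cong_trans)
  have \<psi>: "subgroup_char N H (\<lambda>_. 1)" by (simp add: subgroup_char_def)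
  obtain d where d: "d > 0" "a ^ d \<in> H" "\<And>i. 0 < i \<Longrightarrow> i < d \<Longrightarrow> a ^ i \<notin> H"
    using exists_least_power_in_unit_subgroup[OF H a(1) N] by blast
  have "d \<noteq> 1" using d(2) a(2) by (auto simp: H_def)
  define z where "z = cis (2 * pi / d)"
  have "z ^ d = 1" using d(1) by (simp add: z_def Complex.DeMoivre)
  moreover have "z \<noteq> 1"
  proof
    assume "z = 1"
    hence "cos (2 * pi / d) = 1" by (simp add: z_def complex_eq_iff)
    then obtain n :: int where "2 * pi / d = n * 2 * pi" by (auto simp: cos_one_2pi_int)
    hence "1 = real_of_int n * real d" using d(1) by (simp add: field_simps)
    hence "1 = n * int d" by (metis of_int_1 of_int_mult of_int_of_nat_eq of_int_eq_iff)
    hence "int d dvd 1" by (metis dvd_triv_right)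
    thus False using \<open>d \<noteq> 1\<close> by simp
  qed
  ultimately obtain H' \<psi>' where H': "unit_subgroup N H'" "subgroup_char N H' \<psi>'" "a \<in> H'" "\<psi>' a \<noteq> 1"
    using subgroup_char_extend_step[OF H \<psi> a(1) d, of z] by metis
  obtain \<xi> where "residue_char N \<xi>" "\<forall>h\<in>H'. \<xi> h = \<psi>' h"
    using subgroup_char_extend[OF N H'(1,2)] by blast
  thus ?thesis using H'(3,4) by metis
qed

section \<open>Values of characters and orthogonality\<close>

lemma
  assumes "residue_char N \<xi>"
  shows residue_char_cong: "[m = n] (mod N) \<Longrightarrow> \<xi> m = \<xi> n"
    and residue_char_mult: "\<xi> (m * n) = \<xi> m * \<xi> n"
    and residue_char_nonzero_iff: "\<xi> n \<noteq> 0 \<longleftrightarrow> coprime n N"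
    and residue_char_eq_0: "\<not> coprime n N \<Longrightarrow> \<xi> n = 0"
    and residue_char_1: "\<xi> 1 = 1"
proof -
  show "[m = n] (mod N) \<Longrightarrow> \<xi> m = \<xi> n" "\<xi> (m * n) = \<xi> m * \<xi> n" "\<xi> n \<noteq> 0 \<longleftrightarrow> coprime n N"
    "\<not> coprime n N \<Longrightarrow> \<xi> n = 0" 
    using assms unfolding residue_char_def by blast+
  have "\<xi> 1 * \<xi> 1 = \<xi> 1" "\<xi> 1 \<noteq> 0"
    using assms unfolding residue_char_def by (metis mult_1, simp)
  thus "\<xi> 1 = 1" by simp
qed

lemma residue_char_power:
  assumes "residue_char N \<xi>"
  shows "\<xi> (n ^ k) = \<xi> n ^ k"
  using residue_char_mult[OF assms] residue_char_1[OF assms] by (induction k) simp_all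

lemma residue_char_root_of_unity:
  assumes "residue_char N \<xi>" "coprime n N"
  shows "\<xi> n ^ totient N = 1"
  using residue_char_power[OF assms(1), of n "totient N"] residue_char_1[OF assms(1)]
    residue_char_cong[OF assms(1) euler_theorem[OF assms(2)]] by simp

lemma norm_residue_char:
  assumes "residue_char N \<xi>" "coprime n N" "N > 0"
  shows "norm (\<xi> n) = 1"
  using power_eq_1_iff[OF residue_char_root_of_unity[OF assms(1,2)]] assms(3) by auto

lemma norm_residue_char_le:
  assumes "residue_char N \<xi>" "N > 0"
  shows "norm (\<xi> n) \<le> 1"
  using norm_residue_char[OF assms(1) _ assms(2), of n] residue_char_eq_0[OF assms(1), of n]
  by (cases "coprime n N") auto

lemma residue_char_principal: "residue_char N (principal_char N)"
  unfolding residue_char_def principal_char_def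
  using coprime_cong_cong_left by auto

lemma residue_char_times:
  assumes "residue_char N \<xi>" "residue_char N \<psi>"
  shows "residue_char N (\<lambda>n. \<xi> n * \<psi> n)"
  unfolding residue_char_def
proof (intro conjI allI impI)
  fix m n
  show "\<xi> m * \<psi> m = \<xi> n * \<psi> n" if "[m = n] (mod N)"
    using residue_char_cong[OF assms(1) that] residue_char_cong[OF assms(2) that] by simp
  show "\<xi> (m * n) * \<psi> (m * n) = \<xi> m * \<psi> m * (\<xi> n * \<psi> n)"
    by (simp add: residue_char_mult[OF assms(1)] residue_char_mult[OF assms(2)])
  show "\<xi> n * \<psi> n \<noteq> 0 \<longleftrightarrow> coprime n N"
    using residue_char_nonzero_iff[OF assms(1)] residue_char_nonzero_iff[OF assms(2)] by simp
qed

lemma residue_char_cnj: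
  assumes "residue_char N \<xi>"
  shows "residue_char N (\<lambda>n. cnj (\<xi> n))"
  unfolding residue_char_def
  using residue_char_cong[OF assms] residue_char_nonzero_iff[OF assms]
  by (intro conjI allI impI arg_cong[where f = cnj]) (auto simp: residue_char_mult[OF assms])

lemma residue_char_mult_cnj:
  assumes "residue_char N \<xi>" "N > 0"
  shows "\<xi> n * cnj (\<xi> n) = principal_char N n"
  using norm_residue_char[OF assms(1) _ assms(2)] residue_char_eq_0[OF assms(1)]
  by (simp add: principal_char_def complex_norm_square[symmetric])

text \<open>A character is determined by its values on \<open>{..<N}\<close>, and each of these is 0
  or a \<open>totient N\<close>-th root of unity.\<close>

lemma finite_residue_chars:
  assumes "N > 0"
  shows "finite {\<xi>. residue_char N \<xi>}"
proof -
  define R where "R = insert 0 {z :: complex. z ^ totient N = 1}"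
  have "finite {z :: complex. z ^ totient N = 1}"
    using assms by (intro finite_roots_unity) (simp add: Suc_le_eq)
  hence "finite R" by (simp add: R_def)
  hence "finite (PiE {..<N} (\<lambda>_. R))" by (intro finite_PiE) auto
  moreover have "\<xi> n \<in> R" if "residue_char N \<xi>" for \<xi> n
    using residue_char_root_of_unity[OF that, of n] residue_char_eq_0[OF that, of n]
    unfolding R_def by blast
  hence "(\<lambda>\<xi>. restrict \<xi> {..<N}) ` {\<xi>. residue_char N \<xi>} \<subseteq> PiE {..<N} (\<lambda>_. R)"
    by (auto split: if_splits)
  moreover have "inj_on (\<lambda>\<xi>. restrict \<xi> {..<N}) {\<xi>. residue_char N \<xi>}"
  proof (rule inj_onI, rule ext)
    fix \<xi> \<psi> n
    assume *: "\<xi> \<in> {\<xi>. residue_char N \<xi>}" "\<psi> \<in> {\<xi>. residue_char N \<xi>}"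
      and eq: "restrict \<xi> {..<N} = restrict \<psi> {..<N}"
    have "\<xi> (n mod N) = \<psi> (n mod N)"
      using fun_cong[OF eq, of "n mod N"] assms by simp
    moreover have "[n = n mod N] (mod N)" by (simp add: cong_def)
    ultimately show "\<xi> n = \<psi> n" using * residue_char_cong[of N _ n "n mod N"] by (metis mem_Collect_eq)
  qed
  ultimately show ?thesis using finite_imageD finite_subset by blast
qed

text \<open>Multiplication by a character \<open>\<psi>\<close> with
  \<open>\<psi> n \<noteq> 1\<close> permutes the characters, its inverse being multiplication by
  the conjugate. Hence the sum equals \<open>\<psi> n\<close> times itself.\<close>

lemma sum_residue_chars_eq_0:
  assumes N: "N > 0" and n: "\<not> [n = 1] (mod N)"
  shows "(\<Sum>\<xi> | residue_char N \<xi>. \<xi> n) = 0"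
proof (cases "coprime n N")
  case False
  thus ?thesis by (auto intro!: sum.neutral dest: residue_char_eq_0)
next
  case True
  obtain \<psi> where \<psi>: "residue_char N \<psi>" "\<psi> n \<noteq> 1"
    using exists_residue_char_neq_1[OF N True n] by blast
  define S where "S = (\<Sum>\<xi> | residue_char N \<xi>. \<xi> n)"
  have inv: "(\<lambda>k. cnj (\<psi> k) * (\<psi> k * \<xi> k)) = \<xi>" "(\<lambda>k. \<psi> k * (cnj (\<psi> k) * \<xi> k)) = \<xi>" if "residue_char N \<xi>" for \<xi>
    using residue_char_mult_cnj[OF \<psi>(1) N] residue_char_eq_0[OF that]
    by (auto simp: fun_eq_iff principal_char_def mult.commute simp flip: mult.assoc)
  have "S = (\<Sum>\<xi> | residue_char N \<xi>. \<psi> n * \<xi> n)"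
    unfolding S_def
  proof (rule sum.reindex_bij_witness[of _ "\<lambda>\<xi> k. \<psi> k * \<xi> k" "\<lambda>\<xi> k. cnj (\<psi> k) * \<xi> k"])
    fix \<xi> assume "\<xi> \<in> {\<xi>. residue_char N \<xi>}"
    hence \<xi>: "residue_char N \<xi>" by simp
    show "(\<lambda>k. \<psi> k * (cnj (\<psi> k) * \<xi> k)) = \<xi>" "(\<lambda>k. cnj (\<psi> k) * (\<psi> k * \<xi> k)) = \<xi>"
      using inv[OF \<xi>] by blast+
    show "(\<lambda>k. cnj (\<psi> k) * \<xi> k) \<in> {\<xi>. residue_char N \<xi>}" "(\<lambda>k. \<psi> k * \<xi> k) \<in> {\<xi>. residue_char N \<xi>}"
      using residue_char_times[OF \<psi>(1) \<xi>] residue_char_times[OF residue_char_cnj[OF \<psi>(1)] \<xi>] by blast+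
    show "\<psi> n * (cnj (\<psi> n) * \<xi> n) = \<xi> n" using fun_cong[OF inv(2)[OF \<xi>], of n] .
  qed
  also have "\<dots> = \<psi> n * S" by (simp add: S_def sum_distrib_left)
  finally have "S = \<psi> n * S" .
  hence "S = 0" using \<psi>(2) by simp
  thus ?thesis by (simp add: S_def)
qed

text \<open>Conjugation inverts roots of unity, so \<open>cnj (\<xi> a) = \<xi> b\<close> for an
  inverse \<open>b\<close> of \<open>a\<close>, and the sum is the one over
  \<open>\<xi> (n * b)\<close>.\<close>

lemma sum_residue_chars_mult_cnj:
  assumes N: "N > 0" and a: "coprime a N"
  shows "(\<Sum>\<xi> | residue_char N \<xi>. \<xi> n * cnj (\<xi> a)) =
         (if [n = a] (mod N) then of_nat (card {\<xi>. residue_char N \<xi>}) else 0)"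
proof -
  obtain b where "[a * b = Suc 0] (mod N)" using cong_solve_coprime_nat[OF a] by blast
  hence b: "[a * b = 1] (mod N)" by simp
  have cb: "cnj (\<xi> a) = \<xi> b" if "residue_char N \<xi>" for \<xi>
  proof -
    have "\<xi> a * \<xi> b = 1"
      using residue_char_cong[OF that b] residue_char_mult[OF that] residue_char_1[OF that] by simp
    moreover have "\<xi> a * cnj (\<xi> a) = 1"
      using residue_char_mult_cnj[OF that N] a by (simp add: principal_char_def)
    ultimately show ?thesis by (metis mult_cancel_left mult_zero_left zero_neq_one)
  qed
  have "(\<Sum>\<xi> | residue_char N \<xi>. \<xi> n * cnj (\<xi> a)) = (\<Sum>\<xi> | residue_char N \<xi>. \<xi> (n * b))"
    by (intro sum.cong refl) (simp add: cb residue_char_mult)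
  also have "\<dots> = (if [n * b = 1] (mod N) then of_nat (card {\<xi>. residue_char N \<xi>}) else 0)"
  proof (cases "[n * b = 1] (mod N)")
    case True
    hence "(\<Sum>\<xi> | residue_char N \<xi>. \<xi> (n * b)) = (\<Sum>\<xi> | residue_char N \<xi>. 1)"
      by (intro sum.cong refl) (metis mem_Collect_eq residue_char_1 residue_char_cong)
    thus ?thesis using True by simp
  qed (simp add: sum_residue_chars_eq_0[OF N])
  also have "[n * b = 1] (mod N) \<longleftrightarrow> [n = a] (mod N)"
  proof
    assume "[n * b = 1] (mod N)"
    hence "[a * (n * b) = a * 1] (mod N)" by (intro cong_mult cong_refl)
    moreover have "[n * (a * b) = n * 1] (mod N)" using b by (intro cong_mult cong_refl)
    ultimately show "[n = a] (mod N)"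
      by (metis cong_sym cong_trans mult.commute mult.left_commute nat_mult_1)
  next
    assume "[n = a] (mod N)"
    hence "[n * b = a * b] (mod N)" by (intro cong_mult cong_refl)
    thus "[n * b = 1] (mod N)" using b cong_trans by blast
  qed
  finally show ?thesis .
qed

text \<open>The dual argument: multiplication by a unit \<open>a\<close> with
  \<open>\<xi> a \<noteq> 1\<close> permutes the residues.\<close>

lemma sum_residue_char_period:
  assumes N: "N > 0" and \<xi>: "residue_char N \<xi>" "\<xi> \<noteq> principal_char N"
  shows "(\<Sum>n<N. \<xi> n) = 0"
proof -
  obtain a where a: "\<xi> a \<noteq> principal_char N a" using \<xi>(2) by auto
  have cop: "coprime a N"
  proof (rule ccontr)
    assume "\<not> coprime a N"
    thus False using residue_char_eq_0[OF \<xi>(1)] a by (simp add: principal_char_def)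
  qed
  have bij: "bij_betw (\<lambda>n. (a * n) mod N) {..<N} {..<N}"
  proof -
    have inj: "inj_on (\<lambda>n. (a * n) mod N) {..<N}"
    proof (rule inj_onI)
      fix x y assume "x \<in> {..<N}" "y \<in> {..<N}" "(a * x) mod N = (a * y) mod N"
      hence "[x = y] (mod N)" using cong_mult_lcancel_nat[OF cop] by (simp add: cong_def)
      thus "x = y" using \<open>x \<in> _\<close> \<open>y \<in> _\<close> by (simp add: cong_def)
    qed
    moreover have "(\<lambda>n. (a * n) mod N) ` {..<N} \<subseteq> {..<N}" using N by auto
    ultimately show ?thesis by (simp add: bij_betw_def endo_inj_surj)
  qed
  have "(\<Sum>n<N. \<xi> n) = (\<Sum>n<N. \<xi> ((a * n) mod N))"
    using sum.reindex_bij_betw[OF bij, of \<xi>] by simp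
  also have "\<dots> = (\<Sum>n<N. \<xi> a * \<xi> n)"
  proof (rule sum.cong[OF refl])
    fix n
    have "[(a * n) mod N = a * n] (mod N)" by simp
    thus "\<xi> ((a * n) mod N) = \<xi> a * \<xi> n"
      using residue_char_cong[OF \<xi>(1)] residue_char_mult[OF \<xi>(1)] by metis
  qed
  also have "\<dots> = \<xi> a * (\<Sum>n<N. \<xi> n)" by (simp add: sum_distrib_left)
  finally have "(\<Sum>n<N. \<xi> n) = \<xi> a * (\<Sum>n<N. \<xi> n)" .
  moreover have "\<xi> a \<noteq> 1" using a cop by (simp add: principal_char_def)
  ultimately show ?thesis by simp
qed

lemma norm_sum_residue_char_le:
  assumes N: "N > 0" and \<xi>: "residue_char N \<xi>" "\<xi> \<noteq> principal_char N"
  shows "norm (\<Sum>k<n. \<xi> k) \<le> N"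
proof -
  have per: "(\<Sum>k<N * q + r. \<xi> k) = (\<Sum>k<r. \<xi> k)" for q r
  proof (induction q)
    case (Suc q)
    have "(\<Sum>k<N * Suc q + r. \<xi> k) = (\<Sum>k<N + (N * q + r). \<xi> k)" by (simp add: algebra_simps)
    also have "\<dots> = (\<Sum>k<N. \<xi> k) + (\<Sum>k=N..<N + (N * q + r). \<xi> k)"
      by (metis lessThan_atLeast0 le_add1 sum.atLeastLessThan_concat le0)
    also have "(\<Sum>k=N..<N + (N * q + r). \<xi> k) = (\<Sum>k<N * q + r. \<xi> (k + N))"
      using sum.shift_bounds_nat_ivl[of \<xi> 0 N "N * q + r"] by (simp add: lessThan_atLeast0 add.commute)
    also have "\<dots> = (\<Sum>k<N * q + r. \<xi> k)"
      by (intro sum.cong refl residue_char_cong[OF \<xi>(1)]) (simp add: cong_def)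
    finally show ?case using Suc sum_residue_char_period[OF assms] by simp
  qed simp
  have "norm (\<Sum>k<n. \<xi> k) = norm (\<Sum>k<n mod N. \<xi> k)"
    using per[of "n div N" "n mod N"] by simp
  also have "\<dots> \<le> (\<Sum>k<n mod N. 1)"
    by (intro order_trans[OF norm_sum] sum_mono norm_residue_char_le[OF \<xi>(1) N])
  also have "\<dots> \<le> N" using N by (simp add: less_imp_le)
  finally show ?thesis .
qed

section \<open>Dirichlet series and convolution\<close>

text \<open>Because \<open>0 powr -s = 0\<close>, the term at index 0 vanishes for every
  \<open>f\<close>; sums over \<open>{1..}\<close> and over all naturals therefore agree.\<close>

definition dterm :: "(nat \<Rightarrow> complex) \<Rightarrow> real \<Rightarrow> nat \<Rightarrow> complex" where
  "dterm f s n = f n * of_real (real n powr -s)"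

definition dseries :: "(nat \<Rightarrow> complex) \<Rightarrow> real \<Rightarrow> complex" where
  "dseries f s = (\<Sum>\<^sub>\<infinity>n\<in>{1..}. dterm f s n)"

text \<open>At \<open>n = 0\<close> the divisor set is infinite and the sum is 0 by convention, so
  identities are stated for \<open>n > 0\<close>.\<close>

definition dconv :: "(nat \<Rightarrow> complex) \<Rightarrow> (nat \<Rightarrow> complex) \<Rightarrow> nat \<Rightarrow> complex" where
  "dconv f g n = (\<Sum>d | d dvd n. f d * g (n div d))"

text \<open>Groups the pairs \<open>(d, e)\<close> by their product through the bijection
  \<open>(d, e)\<close> to \<open>(d * e, d)\<close>. It serves both Dirichlet products and the
  Lambert series.\<close>

lemma has_sum_divisors:
  fixes g :: "nat \<times> nat \<Rightarrow> 'a :: {topological_comm_monoid_add,t3_space}"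
  assumes "(g has_sum S) ({1..} \<times> {1..})"
  shows "((\<lambda>n. \<Sum>d | d dvd n. g (d, n div d)) has_sum S) {1..}"
proof -
  have "((\<lambda>(n, d). g (d, n div d)) has_sum S) (SIGMA n:{1..}. {d. d dvd n})"
    using assms
    by (rule has_sum_reindex_bij_witness[THEN iffD1, rotated -1,
          where j1 = "\<lambda>(d, e). (d * e, d)" and i1 = "\<lambda>(n, d). (d, n div d)"])
       (auto simp: Suc_le_eq dvd_div_eq_0_iff intro!: Nat.gr0I)
  thus ?thesis
    by (rule has_sum_SigmaD) (simp add: has_sum_finite)
qed

lemma abs_summable_divisors:
  fixes g :: "nat \<times> nat \<Rightarrow> complex"
  assumes "g abs_summable_on ({1..} \<times> {1..})"
  shows "(\<lambda>n. \<Sum>d | d dvd n. g (d, n div d)) abs_summable_on {1..}"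
proof (rule abs_summable_on_comparison_test')
  show "(\<lambda>n. \<Sum>d | d dvd n. norm (g (d, n div d))) summable_on {1..}"
    using has_sum_divisors[of "\<lambda>x. norm (g x)"] assms has_sum_imp_summable has_sum_infsum by blast
qed (rule norm_sum)

lemma infsum_divisors:
  fixes g :: "nat \<times> nat \<Rightarrow> complex"
  assumes "g abs_summable_on ({1..} \<times> {1..})"
  shows "(\<Sum>\<^sub>\<infinity>n\<in>{1..}. \<Sum>d | d dvd n. g (d, n div d)) = infsum g ({1..} \<times> {1..})"
  using has_sum_divisors[OF has_sum_infsum[OF abs_summable_summable[OF assms]]] infsumI by blast

lemma dterm_dconv:
  "dterm (dconv f g) s n = (\<Sum>d | d dvd n. dterm f s d * dterm g s (n div d))"
proof -
  have "f d * g (n div d) * of_real (real n powr -s) = dterm f s d * dterm g s (n div d)" if "d dvd n" for d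
  proof -
    have "real n = real d * real (n div d)" using that by (metis dvd_mult_div_cancel of_nat_mult)
    hence "real n powr -s = real d powr -s * real (n div d) powr -s"
      by (simp only: powr_mult of_nat_0_le_iff)
    thus ?thesis by (simp add: dterm_def)
  qed
  thus ?thesis unfolding dterm_def[of "dconv f g"] dconv_def sum_distrib_right
    by (intro sum.cong refl) simp
qed

lemma
  assumes f: "dterm f s abs_summable_on {1..}" and g: "dterm g s abs_summable_on {1..}"
  shows dconv_abs_summable: "dterm (dconv f g) s abs_summable_on {1..}"
    and dseries_dconv: "dseries (dconv f g) s = dseries f s * dseries g s"
proof -
  let ?h = "\<lambda>(d, e). dterm f s d * dterm g s e"
  have h: "?h abs_summable_on ({1..} \<times> {1..})"
    unfolding abs_summable_on_Sigma_iff
  proof (intro conjI ballI)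
    show "(\<lambda>e. ?h (d, e)) abs_summable_on {1..}" for d
      using g by (auto simp: norm_mult intro: summable_on_cmult_right)
    have "(\<lambda>d. norm (dterm f s d) * infsum (\<lambda>e. norm (dterm g s e)) {1..}) summable_on {1..}"
      using f by (intro summable_on_cmult_left)
    thus "(\<lambda>d. infsum (\<lambda>e. norm (?h (d, e))) {1..}) abs_summable_on {1..}"
      by (simp add: norm_mult infsum_cmult_right' infsum_nonneg)
  qed
  show "dterm (dconv f g) s abs_summable_on {1..}"
    using abs_summable_divisors[OF h] by (simp add: dterm_dconv)
  have "dseries (dconv f g) s = infsum ?h ({1..} \<times> {1..})"
    using infsum_divisors[OF h] by (simp add: dseries_def dterm_dconv)
  also have "\<dots> = (\<Sum>\<^sub>\<infinity>d\<in>{1..}. \<Sum>\<^sub>\<infinity>e\<in>{1..}. dterm f s d * dterm g s e)"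
    using infsum_Sigma_banach[OF abs_summable_summable[OF h]] by simp
  also have "\<dots> = dseries f s * dseries g s"
    by (simp add: dseries_def infsum_cmult_left' infsum_cmult_right')
  finally show "dseries (dconv f g) s = dseries f s * dseries g s" .
qed

section \<open>Algebra of Dirichlet convolution\<close>

lemma dconv_commute: "n > 0 \<Longrightarrow> dconv f g n = dconv g f n"
  unfolding dconv_def
  by (rule sum.reindex_bij_witness[of _ "\<lambda>d. n div d" "\<lambda>d. n div d"])
     (auto simp: div_div_eq_right mult.commute)

lemma dconv_assoc: 
  assumes "n > 0"
  shows "dconv (dconv f g) h n = dconv f (dconv g h) n"
proof -
  have "dconv (dconv f g) h n = (\<Sum>k | k dvd n. \<Sum>d | d dvd k. f d * g (k div d) * h (n div k))"
    by (simp add: dconv_def sum_distrib_right)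
  also have "\<dots> = (\<Sum>(k, d)\<in>(SIGMA k:{k. k dvd n}. {d. d dvd k}). f d * g (k div d) * h (n div k))"
    using assms by (intro sum.Sigma) (auto dest: dvd_pos_nat)
  also have "\<dots> = (\<Sum>(d, e)\<in>(SIGMA d:{d. d dvd n}. {e. e dvd n div d}). f d * (g e * h (n div d div e)))"
    by (rule sum.reindex_bij_witness[of _ "\<lambda>(d, e). (d * e, d)" "\<lambda>(k, d). (d, k div d)"])
       (use assms in \<open>auto simp: dvd_div_iff_mult mult_ac div_mult2_eq dest: dvd_pos_nat intro: dvd_trans
          elim!: dvdE\<close>)
  also have "\<dots> = (\<Sum>d | d dvd n. \<Sum>e | e dvd n div d. f d * (g e * h (n div d div e)))"
    using assms by (intro sum.Sigma[symmetric]) (auto simp: dvd_div_eq_0_iff)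
  finally show ?thesis by (simp add: dconv_def sum_distrib_left)
qed

lemma dconv_cong:
  assumes "n > 0" "\<And>k. k > 0 \<Longrightarrow> f k = f' k" "\<And>k. k > 0 \<Longrightarrow> g k = g' k"
  shows "dconv f g n = dconv f' g' n"
  unfolding dconv_def
proof (intro sum.cong refl arg_cong2[where f = "(*)"])
  fix d assume "d \<in> {d. d dvd n}"
  hence "d > 0" "n div d > 0" using assms(1) by (auto simp: dvd_div_eq_0_iff intro!: Nat.gr0I)
  thus "f d = f' d" "g (n div d) = g' (n div d)" using assms by auto
qed

text \<open>Since \<open>ln\<close> is additive on products, weighting by \<open>ln\<close> obeys
  the product rule; this is the coefficient form of differentiating in \<open>s\<close>.\<close>

lemma dconv_ln:
  assumes "n > 0"
  shows "dconv f g n * of_real (ln n) =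
         dconv (\<lambda>k. f k * of_real (ln k)) g n + dconv f (\<lambda>k. g k * of_real (ln k)) n"
  unfolding dconv_def sum_distrib_right sum.distrib[symmetric]
proof (rule sum.cong[OF refl])
  fix d assume d: "d \<in> {d. d dvd n}"
  hence "d > 0" "n div d > 0" using assms by (auto simp: dvd_div_eq_0_iff intro!: Nat.gr0I)
  moreover have "real n = real d * real (n div d)" using d by (metis dvd_mult_div_cancel of_nat_mult mem_Collect_eq)
  ultimately have "ln (real n) = ln (real d) + ln (real (n div d))" by (simp add: ln_mult)
  thus "f d * g (n div d) * of_real (ln n) =
        f d * of_real (ln d) * g (n div d) + f d * (g (n div d) * of_real (ln (n div d)))"
    by (simp add: algebra_simps)
qed

text \<open>The identity that \<open>mangoldt\<close> summed over the divisors of \<open>n\<close>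
  gives \<open>ln n\<close>, twisted by \<open>c d * c (n div d) = c n\<close>. On series it says
  that the derivative is the series times its logarithmic derivative.\<close>

lemma mult_ln_eq_dconv_mangoldt:
  assumes mult: "\<And>m n. c (m * n) = c m * c n" and "n > 0"
  shows "c n * of_real (ln n) = dconv c (\<lambda>d. c d * mangoldt d) n"
proof -
  have "dconv c (\<lambda>d. c d * mangoldt d) n = dconv (\<lambda>d. c d * mangoldt d) c n"
    using assms(2) by (rule dconv_commute)
  also have "\<dots> = (\<Sum>d | d dvd n. c n * mangoldt d)"
    unfolding dconv_def
  proof (intro sum.cong refl)
    fix d assume "d \<in> {d. d dvd n}"
    hence "c d * c (n div d) = c n" by (metis mult dvd_mult_div_cancel mem_Collect_eq)
    thus "c d * mangoldt d * c (n div d) = c n * mangoldt d" by (metis mult.assoc mult.commute)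
  qed
  also have "\<dots> = c n * of_real (ln n)"
    using mangoldt_sum[of n, where ?'a = complex] assms(2) by (simp flip: sum_distrib_left)
  finally show ?thesis ..
qed

text \<open>The coefficients of a product of Dirichlet series; the starting function is the unit of
  convolution.\<close>

definition dconv_list :: "(nat \<Rightarrow> complex) list \<Rightarrow> nat \<Rightarrow> complex" where
  "dconv_list cs = foldr dconv cs (\<lambda>n. if n = 1 then 1 else 0)"

lemma dconv_list_1:
  assumes "\<And>c. c \<in> set cs \<Longrightarrow> c 1 = 1"
  shows "dconv_list cs 1 = 1"
  using assms by (induction cs) (auto simp: dconv_list_def dconv_def)

lemma dseries_delta:
  "dterm (\<lambda>n. if n = 1 then 1 else 0) s abs_summable_on {1..}" "dseries (\<lambda>n. if n = 1 then 1 else 0) s = 1"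
proof -
  have "(dterm (\<lambda>n. if n = 1 then 1 else 0) s has_sum 1) {1..}"
    by (rule has_sum_finite_neutralI[of "{1}"]) (auto simp: dterm_def)
  thus "dseries (\<lambda>n. if n = 1 then 1 else 0) s = 1" "dterm (\<lambda>n. if n = 1 then 1 else 0) s abs_summable_on {1..}"
    unfolding dseries_def using infsumI has_sum_imp_summable summable_on_iff_abs_summable_on_complex by blast+
qed

lemma
  assumes "\<And>c. c \<in> set cs \<Longrightarrow> dterm c s abs_summable_on {1..}"
  shows dconv_list_abs_summable: "dterm (dconv_list cs) s abs_summable_on {1..}"
    and dseries_dconv_list: "dseries (dconv_list cs) s = (\<Prod>c\<leftarrow>cs. dseries c s)"
proof -
  have "dterm (dconv_list cs) s abs_summable_on {1..} \<and> dseries (dconv_list cs) s = (\<Prod>c\<leftarrow>cs. dseries c s)"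
    using assms
  proof (induction cs)
    case Nil
    thus ?case using dseries_delta[of s] by (simp add: dconv_list_def)
  next
    case (Cons c cs)
    have eq: "dconv_list (c # cs) = dconv c (dconv_list cs)" by (simp add: dconv_list_def)
    show ?case unfolding eq using Cons dconv_abs_summable[of c s "dconv_list cs"] dseries_dconv[of c s "dconv_list cs"]
      by simp
  qed
  thus "dterm (dconv_list cs) s abs_summable_on {1..}" "dseries (dconv_list cs) s = (\<Prod>c\<leftarrow>cs. dseries c s)" by auto
qed

text \<open>The logarithmic derivative of a product is the sum of the logarithmic derivatives of its
  factors.\<close>

lemma dconv_list_mult_ln:
  assumes "\<And>c m n. c \<in> set cs \<Longrightarrow> c (m * n) = c m * c n" and "n > 0"
  shows "dconv_list cs n * of_real (ln n) = dconv (dconv_list cs) (\<lambda>d. (\<Sum>c\<leftarrow>cs. c d) * mangoldt d) n"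
  using assms
proof (induction cs arbitrary: n)
  case Nil
  thus ?case by (cases "n = 1") (auto simp: dconv_list_def dconv_def intro!: sum.neutral)
next
  case (Cons c cs)
  define F where "F = dconv_list cs"
  define G where "G = (\<lambda>d. (\<Sum>c\<leftarrow>cs. c d) * mangoldt d :: complex)"
  define \<Lambda>c where "\<Lambda>c = (\<lambda>d. c d * mangoldt d :: complex)"
  have eq: "dconv_list (c # cs) = dconv c F" by (simp add: dconv_list_def F_def)
  have 1: "c k * of_real (ln k) = dconv \<Lambda>c c k" if "k > 0" for k
    using mult_ln_eq_dconv_mangoldt[of c k] Cons.prems(1) that dconv_commute[OF that, of c]
    by (simp add: \<Lambda>c_def)
  have 2: "F k * of_real (ln k) = dconv F G k" if "k > 0" for k
    using Cons.IH[OF _ that] Cons.prems(1) by (simp add: F_def G_def)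
  have "dconv c F n * of_real (ln n) =
        dconv (\<lambda>k. c k * of_real (ln k)) F n + dconv c (\<lambda>k. F k * of_real (ln k)) n"
    using \<open>n > 0\<close> by (rule dconv_ln)
  also have "dconv (\<lambda>k. c k * of_real (ln k)) F n = dconv (dconv \<Lambda>c c) F n"
    using \<open>n > 0\<close> 1 by (intro dconv_cong) auto
  also have "\<dots> = dconv (dconv c F) \<Lambda>c n"
    using \<open>n > 0\<close> by (simp add: dconv_assoc dconv_commute[of n \<Lambda>c])
  also have "dconv c (\<lambda>k. F k * of_real (ln k)) n = dconv c (dconv F G) n"
    using \<open>n > 0\<close> 2 by (intro dconv_cong) auto
  also have "\<dots> = dconv (dconv c F) G n"
    using \<open>n > 0\<close> by (simp add: dconv_assoc)
  also have "dconv (dconv c F) \<Lambda>c n + dconv (dconv c F) G n = dconv (dconv c F) (\<lambda>d. \<Lambda>c d + G d) n"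
    by (simp add: dconv_def[of "dconv c F"] sum.distrib algebra_simps)
  also have "(\<lambda>d. \<Lambda>c d + G d) = (\<lambda>d. (\<Sum>c\<leftarrow>c # cs. c d) * mangoldt d)"
    by (simp add: \<Lambda>c_def G_def fun_eq_iff algebra_simps)
  finally show ?case by (simp only: eq)
qed

lemma nonneg_Reals_sum:
  assumes "\<And>x. x \<in> A \<Longrightarrow> f x \<in> \<real>\<^sub>\<ge>\<^sub>0"
  shows "(\<Sum>x\<in>A. f x :: complex) \<in> \<real>\<^sub>\<ge>\<^sub>0"
  using assms by (induction A rule: infinite_finite_induct) auto

text \<open>The logarithmic derivative determines the coefficients recursively from the nonnegative
  numbers \<open>\<Sum>c\<leftarrow>cs. c d\<close>; no multiplicativity or Euler product is needed.\<close>

lemma dconv_list_nonneg: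
  assumes "\<And>c m n. c \<in> set cs \<Longrightarrow> c (m * n) = c m * c n" and "\<And>c. c \<in> set cs \<Longrightarrow> c 1 = 1"
    and nonneg: "\<And>d. (\<Sum>c\<leftarrow>cs. c d) \<in> \<real>\<^sub>\<ge>\<^sub>0" and "n > 0"
  shows "dconv_list cs n \<in> \<real>\<^sub>\<ge>\<^sub>0"
  using \<open>n > 0\<close>
proof (induction n rule: less_induct)
  case (less n)
  show ?case
  proof (cases "n = 1")
    case True
    thus ?thesis using dconv_list_1[of cs] assms(2) by simp
  next
    case False
    hence n: "n > 1" using less.prems by simp
    have mang: "mangoldt d \<in> (\<real>\<^sub>\<ge>\<^sub>0 :: complex set)" for d
      using nonneg_Reals_of_real_iff[of "mangoldt d"] mangoldt_nonneg[of d] by simp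
    have eq: "dconv_list cs n * of_real (ln n) = dconv (dconv_list cs) (\<lambda>d. (\<Sum>c\<leftarrow>cs. c d) * mangoldt d) n"
      using dconv_list_mult_ln[of cs n] assms(1) less.prems by blast
    have "dconv_list cs n * of_real (ln n) \<in> \<real>\<^sub>\<ge>\<^sub>0"
      unfolding eq dconv_def
    proof (rule nonneg_Reals_sum)
      fix d assume "d \<in> {d. d dvd n}"
      hence d: "d dvd n" "d > 0" "d \<le> n" using n by (auto intro: dvd_imp_le Nat.gr0I)
      \<comment> \<open>The divisor \<open>d = n\<close> would bring in the unknown coefficient
        itself, but its factor is \<open>mangoldt 1 = 0\<close>.\<close>
      show "dconv_list cs d * ((\<Sum>c\<leftarrow>cs. c (n div d)) * mangoldt (n div d)) \<in> \<real>\<^sub>\<ge>\<^sub>0"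
      proof (cases "d = n")
        case True
        thus ?thesis using n by simp
      next
        case False
        thus ?thesis using less.IH[of d] d nonneg mang by (intro nonneg_Reals_mult_I) auto
      qed
    qed
    moreover have "ln (real n) > 0" using n by simp
    ultimately show ?thesis
      by (auto simp: complex_nonneg_Reals_iff zero_le_mult_iff)
  qed
qed

text \<open>The term at \<open>n = 1\<close> is 1 and all other terms are nonnegative.\<close>

lemma dconv_list_dseries_ge_1:
  assumes "\<And>c m n. c \<in> set cs \<Longrightarrow> c (m * n) = c m * c n" and "\<And>c. c \<in> set cs \<Longrightarrow> c 1 = 1"
    and "\<And>d. (\<Sum>c\<leftarrow>cs. c d) \<in> \<real>\<^sub>\<ge>\<^sub>0"
    and summ: "\<And>c. c \<in> set cs \<Longrightarrow> dterm c s abs_summable_on {1..}"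
  shows "norm (\<Prod>c\<leftarrow>cs. dseries c s) \<ge> 1"
proof -
  have abs: "dterm (dconv_list cs) s abs_summable_on {1..}"
    using dconv_list_abs_summable[of cs s] summ by blast
  have nonneg: "dconv_list cs n \<in> \<real>\<^sub>\<ge>\<^sub>0" if "n > 0" for n
    using dconv_list_nonneg[of cs n] assms(1-3) that by blast
  have nn: "Re (dterm (dconv_list cs) s n) \<ge> 0" if "n > 0" for n
    using nonneg[OF that] by (simp add: dterm_def complex_nonneg_Reals_iff)
  have "1 = (\<Sum>n\<in>{1}. Re (dterm (dconv_list cs) s n))"
    using dconv_list_1[of cs] assms(2) by (simp add: dterm_def)
  also have "\<dots> \<le> (\<Sum>\<^sub>\<infinity>n\<in>{1..}. Re (dterm (dconv_list cs) s n))"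
    by (rule finite_sum_le_infsum[OF summable_on_Re[OF abs_summable_summable[OF abs]]])
       (use nn in \<open>auto simp: Suc_le_eq\<close>)
  also have "\<dots> = Re (dseries (dconv_list cs) s)"
    unfolding dseries_def by (rule infsum_Re[OF abs_summable_summable[OF abs]])
  also have "\<dots> \<le> norm (dseries (dconv_list cs) s)" by (rule complex_Re_le_cmod)
  finally show ?thesis using dseries_dconv_list[of cs s] summ by simp
qed

section \<open>Behaviour near \<open>s = 1\<close>\<close>

lemma sum_mult_by_parts:
  fixes c a :: "nat \<Rightarrow> complex"
  shows "(\<Sum>k<n. c k * a k) = (\<Sum>k<n. c k) * a n + (\<Sum>k<n. (\<Sum>j<Suc k. c j) * (a k - a (Suc k)))"
  by (induction n) (simp_all add: algebra_simps)

text \<open>The boundary term costs \<open>C * a n\<close>, and the differences of \<open>a\<close>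
  telescope to the remaining \<open>C * (a 0 - a n)\<close>.\<close>

lemma norm_sum_mult_decreasing_le:
  fixes c :: "nat \<Rightarrow> complex" and a :: "nat \<Rightarrow> real"
  assumes C: "\<And>n. norm (\<Sum>k<n. c k) \<le> C" and dec: "\<And>k. a (Suc k) \<le> a k" and pos: "\<And>k. a k \<ge> 0"
  shows "norm (\<Sum>k<n. c k * of_real (a k)) \<le> C * a 0"
proof -
  have "norm (\<Sum>k<n. c k * of_real (a k)) \<le>
        norm ((\<Sum>k<n. c k) * of_real (a n)) +
        norm (\<Sum>k<n. (\<Sum>j<Suc k. c j) * (of_real (a k) - of_real (a (Suc k))))"
    unfolding sum_mult_by_parts[of c] by (rule norm_triangle_ineq)
  also have "norm ((\<Sum>k<n. c k) * of_real (a n)) \<le> C * a n"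
    using C[of n] pos[of n] by (simp add: norm_mult mult_right_mono)
  also have "norm (\<Sum>k<n. (\<Sum>j<Suc k. c j) * (of_real (a k) - of_real (a (Suc k)))) \<le>
             (\<Sum>k<n. C * (a k - a (Suc k)))"
  proof (intro order_trans[OF norm_sum] sum_mono)
    fix k
    have "norm (of_real (a k) - of_real (a (Suc k)) :: complex) = a k - a (Suc k)"
      using dec[of k] by (metis abs_of_nonneg diff_ge_0_iff_ge norm_of_real of_real_diff)
    thus "norm ((\<Sum>j<Suc k. c j) * (of_real (a k) - of_real (a (Suc k)))) \<le> C * (a k - a (Suc k))"
      unfolding norm_mult using C[of "Suc k"] dec[of k] by (simp add: mult_right_mono)
  qed
  also have "(\<Sum>k<n. C * (a k - a (Suc k))) = C * (a 0 - a n)"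
    by (simp add: sum_distrib_left[symmetric] sum_lessThan_telescope')
  finally show ?thesis by (simp add: algebra_simps)
qed

text \<open>The factor 2 arises because a block sum starting at \<open>m\<close> is a difference of
  two partial sums.\<close>

lemma norm_sum_ivl_mult_decreasing_le:
  fixes c :: "nat \<Rightarrow> complex" and a :: "nat \<Rightarrow> real"
  assumes C: "\<And>n. norm (\<Sum>k<n. c k) \<le> C"
    and dec: "\<And>k. k \<ge> m \<Longrightarrow> a (Suc k) \<le> a k" and pos: "\<And>k. k \<ge> m \<Longrightarrow> a k \<ge> 0"
  shows "norm (\<Sum>k=m..<n. c k * of_real (a k)) \<le> 2 * C * a m"
proof -
  have C0: "C \<ge> 0" using C[of 0] by simp
  have "norm (\<Sum>k<j. c (k + m)) \<le> 2 * C" for j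
  proof -
    have "(\<Sum>k<j. c (k + m)) = (\<Sum>k<j + m. c k) - (\<Sum>k<m. c k)"
      by (induction j) (simp_all add: algebra_simps)
    thus ?thesis using norm_triangle_ineq4[of "\<Sum>k<j + m. c k" "\<Sum>k<m. c k"] C[of "j + m"] C[of m] by simp
  qed
  hence "norm (\<Sum>k<n - m. c (k + m) * of_real (a (k + m))) \<le> 2 * C * a (0 + m)"
    using dec pos by (intro norm_sum_mult_decreasing_le) auto
  moreover have "(\<Sum>k=m..<n. c k * of_real (a k)) = (\<Sum>k<n - m. c (k + m) * of_real (a (k + m)))"
    by (rule sum.reindex_bij_witness[of _ "\<lambda>k. k + m" "\<lambda>k. k - m"]) auto
  ultimately show ?thesis by simp
qed

lemma dterm_sums:
  assumes "dterm f s abs_summable_on {1..}"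
  shows "dterm f s sums dseries f s"
proof -
  have "(dterm f s has_sum dseries f s) {1..}"
    unfolding dseries_def by (rule has_sum_infsum[OF abs_summable_summable[OF assms]])
  also have "?this \<longleftrightarrow> (dterm f s has_sum dseries f s) UNIV"
    by (rule has_sum_cong_neutral) (auto simp: dterm_def)
  finally have "(dterm f s has_sum dseries f s) UNIV" .
  thus ?thesis by (rule has_sum_imp_sums)
qed

text \<open>The bound \<open>1 + ln n\<close> is wide enough for characters and for their products
  with \<open>ln\<close> or \<open>mangoldt\<close>.\<close>

lemma dterm_abs_summable:
  fixes f :: "nat \<Rightarrow> complex"
  assumes s: "s > 1" and f: "\<And>n. n > 0 \<Longrightarrow> norm (f n) \<le> 1 + ln n"
  shows "dterm f s abs_summable_on {1..}"
proof -
  \<comment> \<open>Half of the room above 1 absorbs the logarithm as \<open>n powr e / e\<close>;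
    the exponent \<open>e - s\<close> stays below \<open>-1\<close>.\<close>
  define e where "e = (s - 1) / 2"
  have e: "e > 0" using s by (simp add: e_def)
  have "summable (\<lambda>n. (1 + 1 / e) * real n powr (e - s))"
    using s by (intro summable_mult) (simp add: summable_real_powr_iff e_def field_simps)
  hence "(\<lambda>n. (1 + 1 / e) * real n powr (e - s)) summable_on UNIV"
    using e by (intro summable_nonneg_imp_summable_on) auto
  hence sm: "(\<lambda>n. (1 + 1 / e) * real n powr (e - s)) summable_on {1..}"
    by (rule summable_on_subset) auto
  show ?thesis
  proof (rule abs_summable_on_comparison_test'[OF sm])
    fix n :: nat assume "n \<in> {1..}"
    hence n: "n \<ge> 1" by simp
    have "ln (real n) \<le> real n powr e / e" using n e by (intro ln_powr_bound) auto
    moreover have "1 \<le> real n powr e" using n e by (intro ge_one_powr_ge_zero) auto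
    ultimately have "1 + ln (real n) \<le> (1 + 1 / e) * real n powr e" by (simp add: algebra_simps)
    hence "norm (f n) \<le> (1 + 1 / e) * real n powr e" using f[of n] n by simp
    hence "norm (f n) * real n powr -s \<le> (1 + 1 / e) * real n powr e * real n powr -s"
      by (intro mult_right_mono) auto
    thus "norm (dterm f s n) \<le> (1 + 1 / e) * real n powr (e - s)"
      by (simp add: dterm_def norm_mult powr_add[symmetric] mult.assoc)
  qed
qed

lemma dterm_abs_summable_of_bounded:
  fixes f :: "nat \<Rightarrow> complex"
  assumes "s > 1" and f: "\<And>n. norm (f n) \<le> 1"
  shows "dterm f s abs_summable_on {1..}"
proof (rule dterm_abs_summable[OF assms(1)])
  fix n :: nat assume "n > 0"
  hence "ln (real n) \<ge> 0" by simp
  thus "norm (f n) \<le> 1 + ln (real n)" using f[of n] by linarith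
qed

text \<open>A discrete derivative bound, from \<open>1 - exp (-u) \<le> u\<close> and
  \<open>ln (1 + 1 / k) \<le> 1 / k\<close>. The factor \<open>\<delta>\<close> is what later makes
  errors linear in \<open>\<delta>\<close>.\<close>

lemma powr_diff_le:
  fixes \<delta> :: real
  assumes "k > 0" "\<delta> > 0"
  shows "real k powr -\<delta> - real (Suc k) powr -\<delta> \<le> \<delta> / k"
proof -
  have k: "real k > 0" using assms by simp
  have nz: "1 + 1 / real k \<noteq> 0" using divide_pos_pos[OF zero_less_one k] by linarith
  have "real (Suc k) = real k * (1 + 1 / k)" using k by (simp add: field_simps)
  hence "real (Suc k) powr -\<delta> = real k powr -\<delta> * (1 + 1 / k) powr -\<delta>"
    using k by (simp add: powr_mult)
  hence "real k powr -\<delta> - real (Suc k) powr -\<delta> = real k powr -\<delta> * (1 - (1 + 1 / k) powr -\<delta>)"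
    by (simp add: algebra_simps)
  also have "\<dots> \<le> 1 * (1 - (1 + 1 / k) powr -\<delta>)"
  proof (rule mult_right_mono)
    have "real k powr -\<delta> \<le> real k powr 0" using assms by (intro powr_mono) auto
    thus "real k powr -\<delta> \<le> 1" using k by simp
    have "(1 + 1 / k) powr -\<delta> \<le> (1 + 1 / k) powr 0" using assms by (intro powr_mono) auto
    thus "0 \<le> 1 - (1 + 1 / k) powr -\<delta>" by (simp split: if_splits)
  qed
  also have "(1 + 1 / k) powr -\<delta> = exp (- \<delta> * ln (1 + 1 / k))"
    using nz by (simp add: powr_def)
  also have "1 * (1 - exp (- \<delta> * ln (1 + 1 / k))) \<le> \<delta> * ln (1 + 1 / k)"
    using exp_ge_add_one_self[of "- \<delta> * ln (1 + 1 / k)"] by simp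
  also have "\<dots> \<le> \<delta> * (1 / k)"
    using assms k by (intro mult_left_mono ln_add_one_self_le_self) auto
  finally show ?thesis by simp
qed

text \<open>The sum telescopes; its term at \<open>k = 0\<close> is
  \<open>1 / 0 = 0\<close>.\<close>

lemma sum_inverse_consecutive_le: "(\<Sum>k<n. 1 / (real k * real (Suc k))) \<le> 1"
proof -
  have "(\<Sum>k<Suc n. 1 / (real k * real (Suc k))) = 1 - 1 / real (Suc n)" for n
  proof (induction n)
    case (Suc n)
    have "(\<Sum>k<Suc (Suc n). 1 / (real k * real (Suc k))) =
          1 - 1 / real (Suc n) + 1 / (real (Suc n) * real (Suc (Suc n)))"
      by (subst sum.lessThan_Suc) (simp only: Suc.IH)
    also have "1 / (real (Suc n) * real (Suc (Suc n))) = 1 / real (Suc n) - 1 / real (Suc (Suc n))"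
      by (subst diff_frac_eq) auto
    finally show ?case by simp
  qed simp
  thus ?thesis by (cases n) (simp_all del: sum.lessThan_Suc)
qed

text \<open>The value of the L-series at \<open>s = 1\<close>. Convergence there is only conditional
  in general, hence an ordered sum instead of the unordered one in \<open>dseries\<close>.\<close>

definition L1 :: "(nat \<Rightarrow> complex) \<Rightarrow> complex" where
  "L1 c = (\<Sum>n. c n / of_nat n)"

lemma sum_lessThan_split:
  fixes f :: "nat \<Rightarrow> 'a :: comm_monoid_add"
  assumes "m \<le> n"
  shows "(\<Sum>k<n. f k) = (\<Sum>k<m. f k) + (\<Sum>k=m..<n. f k)"
  using sum.atLeastLessThan_concat[of 0 m n f] assms by (simp add: lessThan_atLeast0)

text \<open>Isolates what the estimates near 1 use of a nonprincipal character; there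
  \<open>B\<close> is the modulus.\<close>

locale bounded_partial_sums =
  fixes c :: "nat \<Rightarrow> complex" and B :: real
  assumes bounded: "norm (\<Sum>k<n. c k) \<le> B" and norm_le_1: "norm (c n) \<le> 1"
begin

lemma B_nonneg: "B \<ge> 0"
  using bounded[of 0] by simp

lemma tail_le:
  assumes "m > 0"
  shows "norm (\<Sum>k=m..<n. c k / of_nat k) \<le> 2 * B / m"
proof -
  have "norm (\<Sum>k=m..<n. c k * of_real (1 / real k)) \<le> 2 * B * (1 / real m)"
    using assms by (intro norm_sum_ivl_mult_decreasing_le bounded) (auto simp: field_simps)
  thus ?thesis by simp
qed

lemma L1_sums: "(\<lambda>n. c n / of_nat n) sums L1 c"
proof -
  have "summable (\<lambda>n. c n / of_nat n)"
    unfolding summable_Cauchy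
  proof (intro allI impI)
    fix e :: real assume e: "e > 0"
    obtain N :: nat where N: "real N > 2 * B / e" using reals_Archimedean2 by blast
    have "2 * B / e \<ge> 0" using B_nonneg e by simp
    hence N0: "N > 0" using N by (intro Nat.gr0I) auto
    have "norm (\<Sum>k=m..<n. c k / of_nat k) < e" if "m \<ge> N" for m n
    proof -
      have m: "m > 0" "real m \<ge> real N" using that N0 by auto
      have "2 * B / m \<le> 2 * B / N" using m N0 B_nonneg by (intro divide_left_mono) auto
      also have "\<dots> < e" using N N0 e by (simp add: field_simps)
      finally show ?thesis using tail_le[OF m(1), of n] by linarith
    qed
    thus "\<exists>N. \<forall>m\<ge>N. \<forall>n. norm (\<Sum>k=m..<n. c k / of_nat k) < e" by blast
  qed
  thus ?thesis unfolding L1_def by (rule summable_sums)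
qed

lemma partial_sum_diff_le:
  assumes "m > 0"
  shows "norm ((\<Sum>k<m. c k / of_nat k) - L1 c) \<le> 2 * B / m"
proof -
  have "(\<lambda>n. (\<Sum>k<m. c k / of_nat k) - (\<Sum>k<n. c k / of_nat k)) \<longlonglongrightarrow> (\<Sum>k<m. c k / of_nat k) - L1 c"
    using L1_sums by (intro tendsto_intros) (simp add: sums_def)
  hence "(\<lambda>n. norm ((\<Sum>k<m. c k / of_nat k) - (\<Sum>k<n. c k / of_nat k))) \<longlonglongrightarrow>
         norm ((\<Sum>k<m. c k / of_nat k) - L1 c)" by (rule tendsto_norm)
  moreover have "\<forall>\<^sub>F n in sequentially. norm ((\<Sum>k<m. c k / of_nat k) - (\<Sum>k<n. c k / of_nat k)) \<le> 2 * B / m"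
    using eventually_ge_at_top[of m]
  proof eventually_elim
    case (elim n)
    have "(\<Sum>k<n. c k / of_nat k) = (\<Sum>k<m. c k / of_nat k) + (\<Sum>k=m..<n. c k / of_nat k)"
      using elim by (rule sum_lessThan_split)
    thus ?case using tail_le[OF assms, of n] by (simp add: norm_minus_commute)
  qed
  ultimately show ?thesis by (rule tendsto_upperbound) simp
qed

lemma dterm_c_abs_summable: "s > 1 \<Longrightarrow> dterm c s abs_summable_on {1..}"
  using norm_le_1 by (rule dterm_abs_summable_of_bounded[rotated])

text \<open>The maximum with 1 matters only at \<open>k = 0\<close>, where
  \<open>0 powr -\<delta> = 0\<close> would spoil the monotonicity of the weights; the other factor
  vanishes there anyway.\<close>

lemma dterm_c_eq: "dterm c (1 + \<delta>) k = c k / of_nat k * of_real (max 1 (real k) powr -\<delta>)"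
proof (cases "k = 0")
  case False
  hence "real k powr -(1 + \<delta>) = 1 / real k * real k powr -\<delta>"
    using powr_add[of "real k" "-1" "-\<delta>"] powr_minus_divide[of "real k" 1] by simp
  thus ?thesis using False by (simp add: dterm_def max_def)
qed (simp add: dterm_def)

text \<open>Summation by parts pairs the tails of \<open>L1 c\<close>, of size
  \<open>2 * B / Suc k\<close>, with weight differences of at most \<open>\<delta> / k\<close>. The
  products sum to at most \<open>2 * B * \<delta>\<close>; in particular a zero at 1 makes the
  series vanish at least linearly.\<close>

lemma dseries_diff_L1_le:
  assumes \<delta>: "\<delta> > 0"
  shows "norm (dseries c (1 + \<delta>) - L1 c) \<le> 2 * B * \<delta>"
proof -
  define a where "a k = max 1 (real k) powr -\<delta>" for k
  define T where "T n = (\<Sum>k<n. c k / of_nat k)" for n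
  have a0: "a 0 = 1" "a (Suc 0) = 1" and a_le: "a k \<le> 1" and a_pos: "a k \<ge> 0" for k
    using \<delta> powr_mono[of "-\<delta>" 0 "max 1 (real k)"]
    by (auto simp: a_def split: if_splits)
  have a_diff: "0 \<le> a k - a (Suc k)" "a k - a (Suc k) \<le> \<delta> / k" for k
  proof -
    show "0 \<le> a k - a (Suc k)"
      using \<delta> powr_mono2'[of "-\<delta>" "max 1 (real k)" "max 1 (real (Suc k))"] by (simp add: a_def)
    show "a k - a (Suc k) \<le> \<delta> / k"
      using powr_diff_le[of k \<delta>] \<delta> a0 by (cases "k = 0") (auto simp: a_def max_def)
  qed
  have bound: "norm ((\<Sum>k<n. dterm c (1 + \<delta>) k) - L1 c) \<le> 2 * B / n + 2 * B * \<delta>" if n: "n > 0" for n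
  proof -
    have e1: "(\<Sum>k<n. dterm c (1 + \<delta>) k) = T n * a n + (\<Sum>k<n. T (Suc k) * (of_real (a k) - of_real (a (Suc k))))"
      using sum_mult_by_parts[of "\<lambda>k. c k / of_nat k" "\<lambda>k. of_real (a k)" n]
      by (simp add: dterm_c_eq a_def T_def)
    have tel: "(\<Sum>k<n. of_real (a k) - of_real (a (Suc k)) :: complex) = 1 - of_real (a n)"
      using sum_lessThan_telescope'[of "\<lambda>k. complex_of_real (a k)" n] a0 by simp
    \<comment> \<open>The constant \<open>L1 c\<close> is put into the same summed-by-parts shape,
      so that subtraction turns each partial sum into a tail.\<close>
    have e2: "L1 c = L1 c * a n + (\<Sum>k<n. L1 c * (of_real (a k) - of_real (a (Suc k))))"
      unfolding sum_distrib_left[symmetric] tel by (simp add: algebra_simps)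
    have "(\<Sum>k<n. dterm c (1 + \<delta>) k) - L1 c =
        (T n - L1 c) * a n + (\<Sum>k<n. (T (Suc k) - L1 c) * (of_real (a k) - of_real (a (Suc k))))"
      unfolding arg_cong2[where f = "(-)", OF e1 e2] left_diff_distrib sum_subtractf by simp
    hence "norm ((\<Sum>k<n. dterm c (1 + \<delta>) k) - L1 c) \<le> norm ((T n - L1 c) * a n) +
        norm (\<Sum>k<n. (T (Suc k) - L1 c) * (of_real (a k) - of_real (a (Suc k))))"
      by (metis norm_triangle_ineq)
    also have "norm ((T n - L1 c) * a n) \<le> 2 * B / n"
    proof -
      have "norm ((T n - L1 c) * a n) = norm (T n - L1 c) * a n" using a_pos[of n] by (simp add: norm_mult)
      also have "\<dots> \<le> norm (T n - L1 c) * 1" using a_le[of n] by (intro mult_left_mono) auto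
      also have "\<dots> \<le> 2 * B / n" using partial_sum_diff_le[OF n] by (simp add: T_def)
      finally show ?thesis .
    qed
    also have "norm (\<Sum>k<n. (T (Suc k) - L1 c) * (of_real (a k) - of_real (a (Suc k)))) \<le>
               (\<Sum>k<n. 2 * B * \<delta> * (1 / (real k * real (Suc k))))"
    proof (intro order_trans[OF norm_sum] sum_mono)
      fix k
      have "norm (of_real (a k) - of_real (a (Suc k)) :: complex) = a k - a (Suc k)"
        using a_diff(1)[of k] by (metis abs_of_nonneg norm_of_real of_real_diff)
      hence "norm ((T (Suc k) - L1 c) * (of_real (a k) - of_real (a (Suc k)))) = norm (T (Suc k) - L1 c) * (a k - a (Suc k))"
        by (simp add: norm_mult)
      also have "\<dots> \<le> (2 * B / real (Suc k)) * (\<delta> / k)"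
        using partial_sum_diff_le[of "Suc k"] a_diff[of k] B_nonneg
        by (intro mult_mono) (auto simp: T_def simp del: of_nat_Suc)
      finally show "norm ((T (Suc k) - L1 c) * (of_real (a k) - of_real (a (Suc k)))) \<le>
                    2 * B * \<delta> * (1 / (real k * real (Suc k)))"
        by (simp add: mult_ac)
    qed
    also have "\<dots> = 2 * B * \<delta> * (\<Sum>k<n. 1 / (real k * real (Suc k)))"
      by (simp only: sum_distrib_left)
    also have "\<dots> \<le> 2 * B * \<delta> * 1"
      using B_nonneg \<delta> by (intro mult_left_mono sum_inverse_consecutive_le) auto
    finally show ?thesis by simp
  qed
  have "(\<lambda>n. \<Sum>k<n. dterm c (1 + \<delta>) k) \<longlonglongrightarrow> dseries c (1 + \<delta>)"
    using dterm_sums[OF dterm_c_abs_summable, of "1 + \<delta>"] \<delta> by (simp add: sums_def)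
  hence lim1: "(\<lambda>n. norm ((\<Sum>k<n. dterm c (1 + \<delta>) k) - L1 c)) \<longlonglongrightarrow> norm (dseries c (1 + \<delta>) - L1 c)"
    by (intro tendsto_intros)
  have lim2: "(\<lambda>n. 2 * B / real n + 2 * B * \<delta>) \<longlonglongrightarrow> 0 + 2 * B * \<delta>"
    by (intro tendsto_add tendsto_const tendsto_divide_0[OF tendsto_const] filterlim_real_sequentially
          filterlim_at_top_imp_at_infinity)
  show ?thesis
    using tendsto_le[OF trivial_limit_sequentially lim2 lim1 eventually_mono[OF eventually_gt_at_top[of 0] bound]]
    by simp
qed

text \<open>The function \<open>ln k / k\<close> decreases only beyond \<open>exp 1\<close>, so the
  first three terms are split off. The resulting bound on partial sums at \<open>s = 1\<close>
  survives the decreasing weights and is thus uniform in \<open>s\<close>.\<close>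

lemma dseries_ln_bounded:
  obtains C where "\<And>s. s > 1 \<Longrightarrow> norm (dseries (\<lambda>n. c n * of_real (ln n)) s) \<le> C"
proof -
  \<comment> \<open>One constant for both cases: the first two summands are for
    \<open>n \<ge> 3\<close>, the last for shorter sums.\<close>
  define K where "K = norm (\<Sum>k<3. c k * of_real (ln k / k)) + 2 * B * (ln 3 / 3)
                      + (\<Sum>k<3. norm (c k * of_real (ln k / k)))"
  have part: "norm (\<Sum>k<n. c k * of_real (ln k / k)) \<le> K" for n
  proof (cases "n \<ge> 3")
    case True
    have "(\<Sum>k<n. c k * of_real (ln k / k)) =
          (\<Sum>k<3. c k * of_real (ln k / k)) + (\<Sum>k=3..<n. c k * of_real (ln k / k))"
      using True by (rule sum_lessThan_split)
    also have "norm \<dots> \<le> norm (\<Sum>k<3. c k * of_real (ln k / k)) + norm (\<Sum>k=3..<n. c k * of_real (ln k / k))"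
      by (rule norm_triangle_ineq)
    also have "norm (\<Sum>k=3..<n. c k * of_real (ln k / k)) \<le> 2 * B * (ln (real 3) / real 3)"
    proof (rule norm_sum_ivl_mult_decreasing_le[OF bounded])
      fix k :: nat assume "k \<ge> 3"
      hence "exp 1 \<le> real k" using exp_le by linarith
      thus "ln (real (Suc k)) / real (Suc k) \<le> ln (real k) / real k"
        by (intro ln_x_over_x_mono) auto
    qed auto
    finally show ?thesis unfolding K_def using sum_nonneg[of "{..<3::nat}" "\<lambda>k. norm (c k * of_real (ln k / k))"] by simp
  next
    case False
    have "norm (\<Sum>k<n. c k * of_real (ln k / k)) \<le> (\<Sum>k<n. norm (c k * of_real (ln k / k)))"
      by (rule norm_sum)
    also have "\<dots> \<le> (\<Sum>k<3. norm (c k * of_real (ln k / k)))"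
      using False by (intro sum_mono2) auto
    finally show ?thesis unfolding K_def using B_nonneg by (simp add: add_increasing)
  qed
  have "norm (dseries (\<lambda>n. c n * of_real (ln n)) s) \<le> K" if s: "s > 1" for s
  proof -
    define \<delta> where "\<delta> = s - 1"
    have eq: "dterm (\<lambda>n. c n * of_real (ln n)) s k = c k * of_real (ln k / k) * of_real (max 1 (real k) powr -\<delta>)" for k
    proof -
      have "dterm (\<lambda>n. c n * of_real (ln n)) s k = of_real (ln k) * dterm c (1 + \<delta>) k"
        by (simp add: dterm_def \<delta>_def)
      thus ?thesis by (simp add: dterm_c_eq)
    qed
    have "norm (\<Sum>k<n. dterm (\<lambda>n. c n * of_real (ln n)) s k) \<le> K * (max 1 (real 0) powr -\<delta>)" for n
      unfolding eq
    proof (rule norm_sum_mult_decreasing_le[OF part])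
      show "max 1 (real (Suc k)) powr -\<delta> \<le> max 1 (real k) powr -\<delta>" for k
        using s by (intro powr_mono2') (auto simp: \<delta>_def)
    qed auto
    moreover have "dterm (\<lambda>n. c n * of_real (ln n)) s abs_summable_on {1..}"
    proof (rule dterm_abs_summable[OF s])
      fix n :: nat assume "n > 0"
      hence ln: "ln (real n) \<ge> 0" by simp
      have "norm (c n * of_real (ln n)) = norm (c n) * ln n" using ln by (simp add: norm_mult)
      also have "\<dots> \<le> 1 * ln n" using norm_le_1[of n] ln by (intro mult_right_mono)
      finally show "norm (c n * of_real (ln n)) \<le> 1 + ln n" by simp
    qed
    hence "(\<lambda>n. norm (\<Sum>k<n. dterm (\<lambda>n. c n * of_real (ln n)) s k)) \<longlonglongrightarrow> norm (dseries (\<lambda>n. c n * of_real (ln n)) s)"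
      using dterm_sums by (intro tendsto_norm) (simp add: sums_def)
    ultimately show ?thesis by (intro tendsto_upperbound) (auto intro!: always_eventually)
  qed
  thus ?thesis using that by blast
qed

end

text \<open>The integral comparison for zeta in discrete form: each term from index 2 on is at most
  a difference of consecutive values of \<open>k powr -\<delta>\<close> divided by
  \<open>\<delta>\<close>, and these telescope.\<close>

lemma norm_dseries_le_zeta:
  assumes \<delta>: "\<delta> > 0" and f: "\<And>n. norm (f n) \<le> 1"
  shows "norm (dseries f (1 + \<delta>)) \<le> 1 + 1 / \<delta>"
proof -
  have step: "real (Suc k) powr -(1 + \<delta>) \<le> (real k powr -\<delta> - real (Suc k) powr -\<delta>) / \<delta>" if "k > 0" for k
  proof -
    define K where "K = real (Suc k)"
    have k: "real k > 0" "K > 0" "real k = K - 1" using that by (auto simp: K_def)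
    have pos: "1 - 1 / K > 0" using k by simp
    have "real k = K * (1 - 1 / K)" using k by (simp add: right_diff_distrib)
    hence "real k powr -\<delta> = (K * (1 - 1 / K)) powr -\<delta>" by (rule arg_cong)
    also have "\<dots> = K powr -\<delta> * (1 - 1 / K) powr -\<delta>"
      by (rule powr_mult)
    also have "(1 - 1 / K) powr -\<delta> = exp (- \<delta> * ln (1 - 1 / K))"
      using pos by (simp only: powr_def split: if_split) auto
    finally have eq: "real k powr -\<delta> = K powr -\<delta> * exp (- \<delta> * ln (1 - 1 / K))" .
    have "ln (1 - 1 / K) \<le> - (1 / K)"
      using ln_le_minus_one[OF pos] by simp
    hence "\<delta> / K \<le> - \<delta> * ln (1 - 1 / K)"
      using \<delta> mult_left_mono[of "ln (1 - 1 / K)" "- (1 / K)" \<delta>] by simp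
    hence "1 + \<delta> / K \<le> exp (- \<delta> * ln (1 - 1 / K))"
      using exp_ge_add_one_self[of "- \<delta> * ln (1 - 1 / K)"] by linarith
    hence "K powr -\<delta> * (1 + \<delta> / K) \<le> real k powr -\<delta>"
      unfolding eq by (intro mult_left_mono) auto
    hence "\<delta> * (K powr -\<delta> / K) \<le> real k powr -\<delta> - K powr -\<delta>" by (simp add: algebra_simps)
    moreover have "K powr -\<delta> / K = K powr -(1 + \<delta>)"
    proof -
      have "-(1 + \<delta>) = -\<delta> - 1" by simp
      thus ?thesis using powr_diff[of K "-\<delta>" 1] k by (simp only: powr_one)
    qed
    ultimately have "\<delta> * K powr -(1 + \<delta>) \<le> real k powr -\<delta> - K powr -\<delta>" by (simp only:)
    thus ?thesis using \<delta> by (simp only: K_def pos_le_divide_eq mult.commute)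
  qed
  have part: "(\<Sum>k<Suc (Suc n). real k powr -(1 + \<delta>)) \<le> 1 + (1 - real (Suc n) powr -\<delta>) / \<delta>" for n
  proof (induction n)
    case (Suc n)
    thus ?case using step[of "Suc n"] \<delta> by (simp add: diff_divide_distrib)
  qed simp
  have "norm (\<Sum>k<Suc (Suc n). dterm f (1 + \<delta>) k) \<le> 1 + 1 / \<delta>" for n
  proof -
    have "norm (\<Sum>k<Suc (Suc n). dterm f (1 + \<delta>) k) \<le> (\<Sum>k<Suc (Suc n). real k powr -(1 + \<delta>))"
      unfolding dterm_def
      by (intro order_trans[OF norm_sum] sum_mono) (simp add: norm_mult f mult_left_le_one_le)
    also note part[of n]
    also have "1 + (1 - real (Suc n) powr -\<delta>) / \<delta> \<le> 1 + 1 / \<delta>"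
      using \<delta> by (intro add_left_mono divide_right_mono) auto
    finally show ?thesis .
  qed
  moreover have "dterm f (1 + \<delta>) abs_summable_on {1..}"
    using \<delta> f by (intro dterm_abs_summable_of_bounded) auto
  hence "(\<lambda>n. norm (\<Sum>k<n. dterm f (1 + \<delta>) k)) \<longlonglongrightarrow> norm (dseries f (1 + \<delta>))"
    using dterm_sums by (intro tendsto_norm) (simp add: sums_def)
  hence "(\<lambda>n. norm (\<Sum>k<Suc (Suc n). dterm f (1 + \<delta>) k)) \<longlonglongrightarrow> norm (dseries f (1 + \<delta>))"
    by (rule LIMSEQ_Suc[OF LIMSEQ_Suc])
  ultimately show ?thesis by (intro tendsto_upperbound) (auto intro!: always_eventually)
qed

section \<open>Nonvanishing at \<open>s = 1\<close>\<close>

lemma bounded_partial_sums_residue_char: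
  assumes "N > 0" "residue_char N \<xi>" "\<xi> \<noteq> principal_char N"
  shows "bounded_partial_sums \<xi> N"
  using norm_sum_residue_char_le[OF assms] norm_residue_char_le[OF assms(2,1)]
  by unfold_locales

lemma dterm_residue_char_abs_summable:
  assumes "N > 0" "residue_char N \<xi>" "s > 1"
  shows "dterm \<xi> s abs_summable_on {1..}"
  using dterm_abs_summable_of_bounded[OF assms(3) norm_residue_char_le[OF assms(2,1)]] .

lemma norm_prod_dseries_residue_chars_ge_1:
  assumes N: "N > 0" and s: "s > 1"
  shows "norm (\<Prod>\<xi> | residue_char N \<xi>. dseries \<xi> s) \<ge> 1"
proof -
  obtain xs where xs: "distinct xs" "set xs = {\<xi>. residue_char N \<xi>}"
    using finite_distinct_list[OF finite_residue_chars[OF N]] by blast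
  have ch: "residue_char N \<xi>" if "\<xi> \<in> set xs" for \<xi> using that xs(2) by simp
  have "(\<Sum>\<xi>\<leftarrow>xs. \<xi> d) \<in> \<real>\<^sub>\<ge>\<^sub>0" for d
  proof -
    have "(\<Sum>\<xi>\<leftarrow>xs. \<xi> d) = (\<Sum>\<xi> | residue_char N \<xi>. \<xi> d)"
      using sum.distinct_set_conv_list[OF xs(1), of "\<lambda>\<xi>. \<xi> d"] xs(2) by simp
    also have "\<dots> = (\<Sum>\<xi> | residue_char N \<xi>. \<xi> d * cnj (\<xi> 1))"
      by (intro sum.cong refl) (simp add: residue_char_1[simplified])
    finally show ?thesis using sum_residue_chars_mult_cnj[OF N, of 1 d] by simp
  qed
  hence "1 \<le> norm (\<Prod>\<xi>\<leftarrow>xs. dseries \<xi> s)"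
    using residue_char_mult[OF ch] residue_char_1[OF ch]
      dterm_residue_char_abs_summable[OF N ch s]
    by (intro dconv_list_dseries_ge_1) auto
  also have "(\<Prod>\<xi>\<leftarrow>xs. dseries \<xi> s) = (\<Prod>\<xi> | residue_char N \<xi>. dseries \<xi> s)"
    using prod.distinct_set_conv_list[OF xs(1), of "\<lambda>\<xi>. dseries \<xi> s"] xs(2) by simp
  finally show ?thesis .
qed

text \<open>Two zeros at \<open>s = 1\<close> would outweigh the simple pole of the principal series in a product
  that stays \<open>\<ge> 1\<close> in norm.\<close>

lemma L1_zero_unique:
  assumes N: "N > 0"
    and \<xi>: "residue_char N \<xi>" "\<xi> \<noteq> principal_char N" "L1 \<xi> = 0"
    and \<psi>: "residue_char N \<psi>" "\<psi> \<noteq> principal_char N" "L1 \<psi> = 0"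
  shows "\<xi> = \<psi>"
proof (rule ccontr)
  assume neq: "\<xi> \<noteq> \<psi>"
  define X where "X = {\<xi>. residue_char N \<xi>}"
  define Y where "Y = X - {principal_char N, \<xi>, \<psi>}"
  define P where "P = (\<Prod>\<eta>\<in>Y. norm (L1 \<eta>) + 2 * real N)"
  have fin: "finite Y" using finite_residue_chars[OF N] by (simp add: Y_def X_def)
  have X: "X = insert (principal_char N) (insert \<xi> (insert \<psi> Y))"
    using \<xi> \<psi> residue_char_principal by (auto simp: X_def Y_def)
  have P0: "P \<ge> 0" unfolding P_def by (intro prod_nonneg) auto
  \<comment> \<open>The product will be at most \<open>2 / \<delta>\<close> for the pole,
    \<open>(2 * N * \<delta>) ^ 2\<close> for the two zeros and \<open>P\<close> for the rest, that
    is \<open>8 * N ^ 2 * P * \<delta>\<close>; this \<open>\<delta>\<close> makes it smaller than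
    1.\<close>
  define \<delta> where "\<delta> = 1 / (8 * real N ^ 2 * P + 1)"
  have \<delta>: "\<delta> > 0" "\<delta> \<le> 1" using P0 by (simp_all add: \<delta>_def add_nonneg_pos)
  have zero: "norm (dseries \<eta> (1 + \<delta>)) \<le> 2 * real N * \<delta>"
    if "residue_char N \<eta>" "\<eta> \<noteq> principal_char N" "L1 \<eta> = 0" for \<eta>
    using bounded_partial_sums.dseries_diff_L1_le[OF bounded_partial_sums_residue_char[OF N that(1,2)] \<delta>(1)] that(3)
    by simp
  have other: "norm (dseries \<eta> (1 + \<delta>)) \<le> norm (L1 \<eta>) + 2 * real N" if "\<eta> \<in> Y" for \<eta>
  proof -
    have "residue_char N \<eta>" "\<eta> \<noteq> principal_char N" using that by (auto simp: Y_def X_def)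
    hence "norm (dseries \<eta> (1 + \<delta>) - L1 \<eta>) \<le> 2 * real N * \<delta>"
      using bounded_partial_sums.dseries_diff_L1_le bounded_partial_sums_residue_char[OF N] \<delta>(1) by blast
    also have "\<dots> \<le> 2 * real N" using \<delta> by (simp add: mult_left_le)
    finally show ?thesis using norm_triangle_ineq2[of "dseries \<eta> (1 + \<delta>)" "L1 \<eta>"] by linarith
  qed
  have "norm (dseries (principal_char N) (1 + \<delta>)) \<le> 1 + 1 / \<delta>"
    by (rule norm_dseries_le_zeta[OF \<delta>(1)]) (simp add: principal_char_def)
  also have "\<dots> \<le> 2 / \<delta>" using \<delta> by (simp add: field_simps)
  finally have princ: "norm (dseries (principal_char N) (1 + \<delta>)) \<le> 2 / \<delta>" .
  have "1 \<le> norm (\<Prod>\<eta>\<in>X. dseries \<eta> (1 + \<delta>))"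
    unfolding X_def using norm_prod_dseries_residue_chars_ge_1[OF N] \<delta> by simp
  also have "\<dots> = norm (dseries (principal_char N) (1 + \<delta>)) * (norm (dseries \<xi> (1 + \<delta>)) *
                 (norm (dseries \<psi> (1 + \<delta>)) * (\<Prod>\<eta>\<in>Y. norm (dseries \<eta> (1 + \<delta>)))))"
  proof -
    have "principal_char N \<notin> insert \<xi> (insert \<psi> Y)" "\<xi> \<notin> insert \<psi> Y" "\<psi> \<notin> Y"
      using \<xi>(2) \<psi>(2) neq by (auto simp: Y_def)
    thus ?thesis unfolding X using fin by (simp add: norm_mult prod_norm)
  qed
  also have "\<dots> \<le> 2 / \<delta> * (2 * real N * \<delta> * (2 * real N * \<delta> * P))"
    unfolding P_def
    by (intro mult_mono princ zero \<xi> \<psi> prod_mono conjI other mult_nonneg_nonneg prod_nonneg) (use \<delta> in auto)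
  also have "\<dots> = 8 * real N ^ 2 * P * \<delta>"
    using \<delta> by (simp add: field_simps power2_eq_square)
  also have "\<dots> < 1"
  proof -
    define Q where "Q = 8 * real N ^ 2 * P"
    have "Q \<ge> 0" using P0 by (simp add: Q_def)
    hence "Q * (1 / (Q + 1)) < 1" by (simp add: divide_less_eq_1_pos)
    thus ?thesis by (simp only: \<delta>_def Q_def)
  qed
  finally show False by simp
qed

section \<open>Conjugate and real characters\<close>

lemma L1_cnj:
  assumes "N > 0" "residue_char N \<xi>" "\<xi> \<noteq> principal_char N"
  shows "L1 (\<lambda>n. cnj (\<xi> n)) = cnj (L1 \<xi>)"
proof -
  have "(\<lambda>n. cnj (\<xi> n / of_nat n)) sums cnj (L1 \<xi>)"
    using bounded_partial_sums.L1_sums[OF bounded_partial_sums_residue_char[OF assms]] by (simp only: sums_cnj)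
  thus ?thesis unfolding L1_def[of "\<lambda>n. cnj (\<xi> n)"] using sums_unique by fastforce
qed

text \<open>Pair the exponents \<open>i\<close> and \<open>n - i\<close>: the inequality of
  arithmetic and geometric means bounds each pair below by \<open>2 * y ^ n\<close>.\<close>

lemma power_sum_ge:
  fixes y :: real
  assumes "y \<ge> 0"
  shows "(\<Sum>i<Suc n. (y ^ 2) ^ i) \<ge> real (Suc n) * y ^ n"
proof -
  have "2 * (\<Sum>i<Suc n. (y ^ 2) ^ i) = (\<Sum>i<Suc n. (y ^ 2) ^ i) + (\<Sum>i<Suc n. (y ^ 2) ^ (n - i))"
    using sum.nat_diff_reindex[of "\<lambda>i. (y ^ 2) ^ i" "Suc n"] by simp
  also have "\<dots> = (\<Sum>i<Suc n. (y ^ 2) ^ i + (y ^ 2) ^ (n - i))" by (simp only: sum.distrib)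
  also have "\<dots> \<ge> (\<Sum>i<Suc n. 2 * y ^ n)"
  proof (rule sum_mono)
    fix i assume "i \<in> {..<Suc n}"
    hence "y ^ n = y ^ i * y ^ (n - i)" by (simp flip: power_add)
    moreover have "0 \<le> (y ^ i - y ^ (n - i)) ^ 2" by simp
    ultimately show "2 * y ^ n \<le> (y ^ 2) ^ i + (y ^ 2) ^ (n - i)"
      by (simp add: power2_diff power_mult[symmetric] mult.commute mult.left_commute)
  qed
  finally show ?thesis by simp
qed

text \<open>Monsky's argument for real characters. If \<open>L1 c = 0\<close>, then \<open>\<Sum>c n x\<^sup>n / (1 - x\<^sup>n)\<close> is
  minus the series of \<open>c n\<close> against the decreasing coefficients below, hence bounded as
  \<open>x\<close> tends to \<open>1\<close>. Its power series has nonnegative coefficients that equal \<open>1\<close> at every power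
  of the modulus, so it is unbounded.\<close>

definition lambert_coeff :: "real \<Rightarrow> nat \<Rightarrow> real" where
  "lambert_coeff x n = 1 / (real n * (1 - x)) - x ^ n / (1 - x ^ n)"

context
  fixes x :: real
  assumes x: "0 < x" "x < 1"
begin

lemma lambert_coeff_eq:
  assumes "n > 0"
  shows "lambert_coeff x n = (1 / real n - x ^ n / (\<Sum>i<n. x ^ i)) / (1 - x)"
proof -
  have "1 - x ^ n = (1 - x) * (\<Sum>i<n. x ^ i)" by (rule one_diff_power_eq)
  thus ?thesis using x by (simp add: lambert_coeff_def diff_divide_distrib mult.commute)
qed

lemma lambert_coeff_nonneg:
  assumes "n > 0"
  shows "lambert_coeff x n \<ge> 0"
proof -
  have "(\<Sum>i<n. x ^ n) \<le> (\<Sum>i<n. x ^ i)"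
    using x by (intro sum_mono power_decreasing) auto
  moreover have "real n * x ^ n > 0" using assms x by simp
  ultimately have "x ^ n / (\<Sum>i<n. x ^ i) \<le> x ^ n / (real n * x ^ n)"
    using x by (intro divide_left_mono) auto
  also have "\<dots> = 1 / real n" using x by simp
  finally show ?thesis using x assms by (simp add: lambert_coeff_eq)
qed

text \<open>With \<open>S\<close> the geometric sum of length \<open>n\<close>, the claim reduces to
  \<open>n * (n + 1) * x ^ n \<le> S * (S + x ^ n)\<close>. Applying \<open>power_sum_ge\<close> at
  \<open>y = sqrt x\<close> to both factors on the right gives
  \<open>n * (n + 1) * y ^ (2 * n - 1)\<close>, which is more than enough as
  \<open>y < 1\<close>.\<close>

lemma lambert_coeff_decreasing:
  assumes "n > 0"
  shows "lambert_coeff x (Suc n) \<le> lambert_coeff x n"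
proof -
  define S where "S = (\<Sum>i<n. x ^ i)"
  define y where "y = sqrt x"
  have y: "y > 0" "y < 1" "x = y ^ 2" using x by (auto simp: y_def)
  obtain m where m: "n = Suc m" using assms gr0_conv_Suc by blast
  have S': "(\<Sum>i<Suc n. x ^ i) = S + x ^ n" by (simp add: S_def)
  have S: "S > 0" unfolding S_def using x assms by (intro sum_pos) (auto simp: m)
  have "S * (1 - x) = 1 - x ^ n" unfolding S_def using one_diff_power_eq[of x n] by (simp add: mult.commute)
  hence Sx: "S * x = S + x ^ n - 1" by (simp add: algebra_simps)
  have "real n * y ^ m \<le> S" using power_sum_ge[of y m] y by (simp add: S_def m del: sum.lessThan_Suc)
  moreover have "real (Suc n) * y ^ n \<le> S + x ^ n"
    using power_sum_ge[of y n] y S' by (simp del: sum.lessThan_Suc)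
  ultimately have "(real n * y ^ m) * (real (Suc n) * y ^ n) \<le> S * (S + x ^ n)"
    using y S by (intro mult_mono) auto
  moreover have "x ^ n \<le> y ^ m * y ^ n"
  proof -
    have "x ^ n = y ^ (n + n)" by (simp add: y(3) power_mult[symmetric] mult_2)
    also have "\<dots> \<le> y ^ (m + n)" using y by (intro power_decreasing) (auto simp: m)
    finally show ?thesis by (simp add: power_add)
  qed
  hence "real n * real (Suc n) * x ^ n \<le> real n * real (Suc n) * (y ^ m * y ^ n)"
    by (intro mult_left_mono) auto
  ultimately have key: "real n * real (Suc n) * x ^ n \<le> S * (S + x ^ n)" by (simp add: mult_ac)
  have xn: "x ^ n > 0" using x by simp
  have "x ^ n / S - x ^ Suc n / (S + x ^ n) = (x ^ n * (S + x ^ n) - x ^ n * (S * x)) / (S * (S + x ^ n))"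
    using S xn by (subst diff_frac_eq) (auto simp: mult_ac)
  also have "\<dots> = x ^ n / (S * (S + x ^ n))" by (simp add: Sx algebra_simps)
  also have "\<dots> \<le> 1 / (real n * real (Suc n))"
  proof -
    have *: "u / D \<le> 1 / E" if "E * u \<le> D" "D > 0" "E > 0" for u D E :: real
      using that by (simp add: field_simps)
    show ?thesis using key S xn assms by (intro *) (auto intro!: mult_pos_pos add_pos_pos)
  qed
  also have "\<dots> = 1 / real n - 1 / real (Suc n)"
    using assms by (subst diff_frac_eq) auto
  finally have "1 / real (Suc n) - x ^ Suc n / (S + x ^ n) \<le> 1 / real n - x ^ n / S" by linarith
  thus ?thesis using x assms
    by (simp add: lambert_coeff_eq S'[symmetric] S_def[symmetric] divide_right_mono del: sum.lessThan_Suc of_nat_Suc power_Suc)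
qed

lemma norm_lambert_series_le:
  assumes c: "bounded_partial_sums c B" and L: "L1 c = 0" and c0: "c 0 = 0"
    and lam: "(\<lambda>n. c n * of_real (x ^ n / (1 - x ^ n))) sums F"
  shows "norm F \<le> 2 * B"
proof -
  interpret bounded_partial_sums c B by fact
  have "norm (\<Sum>k=1..<n. c k * of_real (lambert_coeff x k)) \<le> 2 * B * lambert_coeff x 1" for n
    by (rule norm_sum_ivl_mult_decreasing_le[OF bounded])
       (auto intro!: lambert_coeff_decreasing lambert_coeff_nonneg)
  \<comment> \<open>The first coefficient does not depend on \<open>x\<close>, so the bound is
    uniform as \<open>x\<close> tends to 1.\<close>
  moreover have "lambert_coeff x 1 = 1" using x by (simp add: lambert_coeff_def diff_divide_distrib[symmetric])
  moreover have "(\<Sum>k=1..<Suc n. c k * of_real (lambert_coeff x k)) = (\<Sum>k<Suc n. c k * of_real (lambert_coeff x k))" for n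
    by (rule sum.mono_neutral_left) (auto simp: c0 not_less_eq_eq)
  ultimately have b: "norm (\<Sum>k<Suc n. c k * of_real (lambert_coeff x k)) \<le> 2 * B" for n
    by (metis mult.right_neutral)
  have "(\<lambda>n. c n / of_nat n * of_real (1 / (1 - x)) - c n * of_real (x ^ n / (1 - x ^ n))) sums
        (L1 c * of_real (1 / (1 - x)) - F)"
    by (intro sums_diff sums_mult2 L1_sums lam)
  also have "(\<lambda>n. c n / of_nat n * of_real (1 / (1 - x)) - c n * of_real (x ^ n / (1 - x ^ n))) =
             (\<lambda>n. c n * of_real (lambert_coeff x n))"
    by (simp add: lambert_coeff_def fun_eq_iff algebra_simps)
  finally have "(\<lambda>n. c n * of_real (lambert_coeff x n)) sums (- F)" by (simp add: L)
  hence "(\<lambda>n. \<Sum>k<n. c k * of_real (lambert_coeff x k)) \<longlonglongrightarrow> - F" by (simp add: sums_def)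
  hence "(\<lambda>n. norm (\<Sum>k<Suc n. c k * of_real (lambert_coeff x k))) \<longlonglongrightarrow> norm (- F)"
    by (intro tendsto_norm LIMSEQ_Suc)
  hence "norm (- F) \<le> 2 * B"
    by (rule tendsto_upperbound) (use b in \<open>auto intro!: always_eventually\<close>)
  thus ?thesis by simp
qed

end

text \<open>Expand each \<open>x ^ d / (1 - x ^ d)\<close> as a geometric series in
  \<open>x ^ d\<close> and collect the exponents \<open>d * e = n\<close>. Absolute convergence
  follows by comparison with \<open>x ^ d / (1 - x)\<close>.\<close>

lemma lambert_series_expansion:
  fixes c :: "nat \<Rightarrow> complex" and x :: real
  assumes x: "0 < x" "x < 1" and c: "\<And>n. norm (c n) \<le> 1" and c0: "c 0 = 0"
  obtains F where "(\<lambda>n. c n * of_real (x ^ n / (1 - x ^ n))) sums F"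
    and "((\<lambda>n. (\<Sum>d | d dvd n. c d) * of_real (x ^ n)) has_sum F) {1..}"
proof -
  let ?g = "\<lambda>(d, e). c d * of_real (x ^ (d * e)) :: complex"
  have xd: "0 < x ^ d" "x ^ d \<le> x" "x ^ d < 1" if "d \<ge> 1" for d
  proof -
    show "0 < x ^ d" using x by simp
    show "x ^ d \<le> x" using power_decreasing[of 1 d x] x that by simp
    thus "x ^ d < 1" using x by linarith
  qed
  have geo: "((\<lambda>e. x ^ (d * e)) has_sum (x ^ d / (1 - x ^ d))) {1..}" if "d \<ge> 1" for d
    using has_sum_geometric_from_1[of "x ^ d"] xd[OF that] by (simp add: power_mult)
  have geoc: "((\<lambda>e. ?g (d, e)) has_sum (c d * of_real (x ^ d / (1 - x ^ d)))) {1..}" if "d \<ge> 1" for d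
    using has_sum_cmult_right[OF has_sum_of_real[OF geo[OF that]], of "c d"] by simp
  have gn: "((\<lambda>e. norm (?g (d, e))) has_sum (norm (c d) * (x ^ d / (1 - x ^ d)))) {1..}" if "d \<ge> 1" for d
    using has_sum_cmult_right[OF geo[OF that], of "norm (c d)"] x by (simp add: norm_mult norm_power)
  have "(\<lambda>d. x ^ d) summable_on {1..}"
    using has_sum_imp_summable[OF has_sum_geometric_from_1[of x]] x by simp
  hence "(\<lambda>d. x ^ d * (1 / (1 - x))) summable_on {1..}" by (rule summable_on_cmult_left)
  hence outer: "(\<lambda>d. norm (c d) * (x ^ d / (1 - x ^ d))) summable_on {1..}"
  proof (rule summable_on_comparison_test)
    fix d :: nat assume "d \<in> {1..}"
    hence d: "d \<ge> 1" by simp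
    have "x ^ d / (1 - x ^ d) \<le> x ^ d / (1 - x)"
      using xd[OF d] x by (intro divide_left_mono mult_pos_pos) auto
    moreover have "norm (c d) * (x ^ d / (1 - x ^ d)) \<le> 1 * (x ^ d / (1 - x ^ d))"
      using xd[OF d] c by (intro mult_right_mono) auto
    ultimately show "norm (c d) * (x ^ d / (1 - x ^ d)) \<le> x ^ d * (1 / (1 - x))" by simp
    show "0 \<le> norm (c d) * (x ^ d / (1 - x ^ d))" using xd[OF d] by simp
  qed
  have g: "?g abs_summable_on ({1..} \<times> {1..})"
    unfolding abs_summable_on_Sigma_iff
  proof (intro conjI ballI)
    fix d :: nat assume "d \<in> {1..}"
    thus "(\<lambda>e. ?g (d, e)) abs_summable_on {1..}" using has_sum_imp_summable[OF gn] by simp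
  next
    have inf: "infsum (\<lambda>e. norm (?g (d, e))) {1..} = norm (c d) * (x ^ d / (1 - x ^ d))" if "d \<in> {1..}" for d
      using infsumI[OF gn] that by simp
    have "(\<lambda>d. norm (norm (c d) * (x ^ d / (1 - x ^ d)))) summable_on {1..}"
      by (rule summable_on_iff_abs_summable_on_real[THEN iffD1, OF outer])
    thus "(\<lambda>d. infsum (\<lambda>e. norm (?g (d, e))) {1..}) abs_summable_on {1..}"
      by (rule summable_on_cong[THEN iffD2, rotated]) (simp only: inf)
  qed
  define F where "F = infsum ?g ({1..} \<times> {1..})"
  have gF: "(?g has_sum F) ({1..} \<times> {1..})"
    unfolding F_def by (rule has_sum_infsum[OF abs_summable_summable[OF g]])
  have "((\<lambda>d. c d * of_real (x ^ d / (1 - x ^ d))) has_sum F) {1..}"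
    by (rule has_sum_SigmaD[OF gF]) (use geoc in auto)
  also have "?this \<longleftrightarrow> ((\<lambda>d. c d * of_real (x ^ d / (1 - x ^ d))) has_sum F) UNIV"
    by (rule has_sum_cong_neutral) (auto simp: c0 not_less_eq_eq)
  finally have "(\<lambda>d. c d * of_real (x ^ d / (1 - x ^ d))) sums F" by (rule has_sum_imp_sums)
  moreover have "((\<lambda>n. (\<Sum>d | d dvd n. c d) * of_real (x ^ n)) has_sum F) {1..}"
  proof -
    have "(\<Sum>d | d dvd n. ?g (d, n div d)) = (\<Sum>d | d dvd n. c d) * of_real (x ^ n)" for n
      unfolding sum_distrib_right by (intro sum.cong refl) auto
    thus ?thesis using has_sum_divisors[OF gF] by simp
  qed
  ultimately show ?thesis using that by blast
qed

text \<open>The divisor sum is the convolution of \<open>\<xi>\<close> with the constant 1, and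
  \<open>\<xi> d + 1 \<ge> 0\<close> since a real character takes values in
  \<open>[-1, 1]\<close>.\<close>

lemma sum_real_char_divisors_nonneg:
  assumes N: "N > 0" and \<xi>: "residue_char N \<xi>" and re: "\<And>n. cnj (\<xi> n) = \<xi> n" and n: "n > 0"
  shows "(\<Sum>d | d dvd n. \<xi> d) \<in> \<real>\<^sub>\<ge>\<^sub>0"
proof -
  have one: "dconv (\<lambda>_. 1) (\<lambda>n. if n = 1 then 1 else 0) k = 1" if "k > 0" for k
  proof -
    have "dconv (\<lambda>_. 1) (\<lambda>n. if n = 1 then 1 else 0) k = (\<Sum>d | d dvd k. if d = k then 1 else 0)"
      unfolding dconv_def
      by (intro sum.cong refl) (use that in \<open>auto elim!: dvdE\<close>)
    thus ?thesis using that by simp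
  qed
  have "dconv_list [\<xi>, \<lambda>_. 1] n = dconv \<xi> (dconv (\<lambda>_. 1) (\<lambda>n. if n = 1 then 1 else 0)) n"
    by (simp only: dconv_list_def foldr.simps o_apply id_apply)
  also have "\<dots> = dconv \<xi> (\<lambda>_. 1) n" by (rule dconv_cong[OF n refl one])
  also have "\<dots> = (\<Sum>d | d dvd n. \<xi> d)" by (simp add: dconv_def)
  finally have "dconv_list [\<xi>, \<lambda>_. 1] n = (\<Sum>d | d dvd n. \<xi> d)" .
  moreover have "dconv_list [\<xi>, \<lambda>_. 1] n \<in> \<real>\<^sub>\<ge>\<^sub>0"
  proof (rule dconv_list_nonneg[OF _ _ _ n])
    fix d
    have "Im (\<xi> d) = 0" using re[of d] by (simp add: complex_eq_iff)
    moreover have "\<bar>Re (\<xi> d)\<bar> \<le> 1"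
      using norm_residue_char_le[OF \<xi> N, of d] abs_Re_le_cmod[of "\<xi> d"] by linarith
    ultimately show "(\<Sum>c\<leftarrow>[\<xi>, \<lambda>_. 1]. c d) \<in> \<real>\<^sub>\<ge>\<^sub>0" by (simp add: complex_nonneg_Reals_iff)
  qed (use residue_char_mult[OF \<xi>] residue_char_1[OF \<xi>] in auto)
  ultimately show ?thesis by simp
qed

lemma sum_char_divisors_modulus_power:
  assumes \<xi>: "residue_char N \<xi>" and N: "N > 0"
  shows "(\<Sum>d | d dvd N ^ k. \<xi> d) = 1"
proof -
  have "(\<Sum>d | d dvd N ^ k. \<xi> d) = (\<Sum>d\<in>{1}. \<xi> d)"
  proof (rule sum.mono_neutral_right)
    show "\<forall>d\<in>{d. d dvd N ^ k} - {1}. \<xi> d = 0"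
    proof
      fix d assume "d \<in> {d. d dvd N ^ k} - {1}"
      hence d: "d dvd N ^ k" "d \<noteq> 1" by auto
      have "\<not> coprime d N"
      proof
        assume "coprime d N"
        hence "coprime d (N ^ k)" by simp
        thus False using d by (metis coprime_absorb_left nat_dvd_1_iff_1)
      qed
      thus "\<xi> d = 0" by (rule residue_char_eq_0[OF \<xi>])
    qed
  qed (use N in auto)
  thus ?thesis using residue_char_1[OF \<xi>] by simp
qed

lemma L1_real_char_nonzero:
  assumes N: "N > 1" and \<xi>: "residue_char N \<xi>" "\<xi> \<noteq> principal_char N" and re: "\<And>n. cnj (\<xi> n) = \<xi> n"
  shows "L1 \<xi> \<noteq> 0"
proof
  assume L: "L1 \<xi> = 0"
  have N0: "N > 0" using N by simp
  have \<xi>0: "\<xi> 0 = 0" using N by (intro residue_char_eq_0[OF \<xi>(1)]) simp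
  \<comment> \<open>As \<open>x\<close> tends to 1, the \<open>K\<close> terms at powers of
    \<open>N\<close> tend to a total of \<open>K\<close>, just above the Lambert bound
    \<open>2 * N\<close>.\<close>
  define K where "K = 2 * N + 1"
  have bound: "(\<Sum>k<K. x ^ (N ^ k)) \<le> 2 * real N" if x: "0 < x" "x < 1" for x :: real
  proof -
    obtain F where F: "(\<lambda>n. \<xi> n * of_real (x ^ n / (1 - x ^ n))) sums F"
      "((\<lambda>n. (\<Sum>d | d dvd n. \<xi> d) * of_real (x ^ n)) has_sum F) {1..}"
      using lambert_series_expansion[where c = \<xi>, OF x norm_residue_char_le[OF \<xi>(1) N0] \<xi>0] by blast
    have nonneg: "Re ((\<Sum>d | d dvd n. \<xi> d) * of_real (x ^ n)) \<ge> 0" if "n \<ge> 1" for n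
      using sum_real_char_divisors_nonneg[OF N0 \<xi>(1) re, of n] that x by (auto simp: complex_nonneg_Reals_iff)
    have "inj_on (\<lambda>k. N ^ k) {..<K}" using N by (intro inj_onI) simp
    hence "(\<Sum>n\<in>(\<lambda>k. N ^ k) ` {..<K}. Re ((\<Sum>d | d dvd n. \<xi> d) * of_real (x ^ n))) =
          (\<Sum>k<K. Re ((\<Sum>d | d dvd N ^ k. \<xi> d) * of_real (x ^ (N ^ k))))"
      by (simp only: sum.reindex o_def)
    also have "\<dots> = (\<Sum>k<K. x ^ (N ^ k))"
      by (simp add: sum_char_divisors_modulus_power[OF \<xi>(1) N0])
    finally have "(\<Sum>k<K. x ^ (N ^ k)) =
      (\<Sum>n\<in>(\<lambda>k. N ^ k) ` {..<K}. Re ((\<Sum>d | d dvd n. \<xi> d) * of_real (x ^ n)))" ..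
    also have "\<dots> \<le> Re F"
      by (rule finite_sum_le_has_sum[OF has_sum_Re[OF F(2)]]) (use N0 nonneg in \<open>auto simp: Suc_le_eq\<close>)
    also have "\<dots> \<le> norm F" by (rule complex_Re_le_cmod)
    also have "\<dots> \<le> 2 * real N"
      using norm_lambert_series_le[OF x bounded_partial_sums_residue_char[OF N0 \<xi>] L \<xi>0 F(1)] .
    finally show ?thesis .
  qed
  have "((\<lambda>x::real. \<Sum>k<K. x ^ (N ^ k)) \<longlongrightarrow> (\<Sum>k<K. 1 ^ (N ^ k))) (at_left 1)"
    by (intro tendsto_intros)
  moreover have "\<forall>\<^sub>F x::real in at_left 1. (\<Sum>k<K. x ^ (N ^ k)) \<le> 2 * real N"
    using eventually_at_left_real[of 0 1] by (rule eventually_mono) (use bound in auto)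
  ultimately have "(\<Sum>k<K. 1 ^ (N ^ k)) \<le> 2 * real N"
    by (rule tendsto_upperbound) simp
  thus False by (simp add: K_def)
qed

text \<open>Conjugation sends a zero to a zero, so uniqueness makes the character equal to its
  conjugate, hence real.\<close>

lemma L1_nonzero:
  assumes N: "N > 1" and \<xi>: "residue_char N \<xi>" "\<xi> \<noteq> principal_char N"
  shows "L1 \<xi> \<noteq> 0"
proof
  assume L: "L1 \<xi> = 0"
  have N0: "N > 0" using N by simp
  define \<psi> where "\<psi> = (\<lambda>n. cnj (\<xi> n))"
  have "residue_char N \<psi>" unfolding \<psi>_def by (rule residue_char_cnj[OF \<xi>(1)])
  moreover have "L1 \<psi> = 0" unfolding \<psi>_def using L1_cnj[OF N0 \<xi>] L by simp
  moreover have "\<psi> \<noteq> principal_char N"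
  proof
    assume eq: "\<psi> = principal_char N"
    have "\<xi> n = principal_char N n" for n
      using fun_cong[OF eq, of n] unfolding \<psi>_def by (simp add: principal_char_def complex_eq_iff split: if_splits)
    thus False using \<xi>(2) by blast
  qed
  ultimately have "\<xi> = \<psi>" using L1_zero_unique[OF N0 \<xi> L] by blast
  hence "cnj (\<xi> n) = \<xi> n" for n unfolding \<psi>_def by metis
  thus False using L1_real_char_nonzero[OF N \<xi>] L by blast
qed

section \<open>Logarithmic derivatives of L-series\<close>

lemma dterm_char_mangoldt_abs_summable:
  assumes "N > 0" "residue_char N \<xi>" "s > 1"
  shows "dterm (\<lambda>n. \<xi> n * mangoldt n) s abs_summable_on {1..}"
proof (rule dterm_abs_summable[OF assms(3)])
  fix n :: nat assume n: "n > 0"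
  have "norm (\<xi> n * mangoldt n) \<le> 1 * mangoldt n"
    unfolding norm_mult norm_mangoldt
    by (intro mult_right_mono norm_residue_char_le[OF assms(2,1)] mangoldt_nonneg)
  thus "norm (\<xi> n * mangoldt n) \<le> 1 + ln n" using mangoldt_le[OF n] by linarith
qed

lemma dseries_char_ln_eq:
  assumes "N > 0" "residue_char N \<xi>" "s > 1"
  shows "dseries (\<lambda>n. \<xi> n * of_real (ln n)) s = dseries \<xi> s * dseries (\<lambda>n. \<xi> n * mangoldt n) s"
proof -
  have "dseries (\<lambda>n. \<xi> n * of_real (ln n)) s = dseries (dconv \<xi> (\<lambda>n. \<xi> n * mangoldt n)) s"
    unfolding dseries_def dterm_def
    by (intro infsum_cong) (simp add: mult_ln_eq_dconv_mangoldt residue_char_mult[OF assms(2)])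
  thus ?thesis
    using dseries_dconv dterm_residue_char_abs_summable[OF assms] dterm_char_mangoldt_abs_summable[OF assms] by simp
qed

text \<open>A quotient whose numerator is bounded and whose denominator tends to
  \<open>L1 \<xi> \<noteq> 0\<close>.\<close>

lemma dseries_char_mangoldt_bounded:
  assumes N: "N > 1" and \<xi>: "residue_char N \<xi>" "\<xi> \<noteq> principal_char N"
  shows "\<exists>K. \<forall>\<^sub>F \<delta> in at_right 0. norm (dseries (\<lambda>n. \<xi> n * mangoldt n) (1 + \<delta>)) \<le> K"
proof -
  have N0: "N > 0" using N by simp
  interpret bounded_partial_sums \<xi> N by (rule bounded_partial_sums_residue_char[OF N0 \<xi>])
  obtain C where C: "\<And>s. s > 1 \<Longrightarrow> norm (dseries (\<lambda>n. \<xi> n * of_real (ln n)) s) \<le> C"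
    using dseries_ln_bounded by blast
  define l where "l = norm (L1 \<xi>)"
  have l: "l > 0" using L1_nonzero[OF N \<xi>] by (simp add: l_def)
  \<comment> \<open>Below \<open>l / (4 * N)\<close> the error \<open>2 * N * \<delta>\<close> is at
    most \<open>l / 2\<close>, so the series keeps norm at least \<open>l / 2\<close>.\<close>
  have "\<forall>\<^sub>F \<delta> in at_right 0. \<delta> \<in> {0<..<l / (4 * N)}"
    using l N by (intro eventually_at_right_real) auto
  hence "\<forall>\<^sub>F \<delta> in at_right 0. norm (dseries (\<lambda>n. \<xi> n * mangoldt n) (1 + \<delta>)) \<le> 2 * C / l"
  proof eventually_elim
    case (elim \<delta>)
    hence \<delta>: "\<delta> > 0" "2 * real N * \<delta> \<le> l / 2" using N by (auto simp: field_simps)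
    have "norm (L1 \<xi>) - norm (dseries \<xi> (1 + \<delta>)) \<le> norm (L1 \<xi> - dseries \<xi> (1 + \<delta>))"
      by (rule norm_triangle_ineq2)
    also have "\<dots> \<le> 2 * real N * \<delta>"
      using dseries_diff_L1_le[OF \<delta>(1)] by (simp add: norm_minus_commute)
    finally have ge: "norm (dseries \<xi> (1 + \<delta>)) \<ge> l / 2" using \<delta>(2) by (simp add: l_def)
    have "l / 2 * norm (dseries (\<lambda>n. \<xi> n * mangoldt n) (1 + \<delta>)) \<le>
          norm (dseries \<xi> (1 + \<delta>)) * norm (dseries (\<lambda>n. \<xi> n * mangoldt n) (1 + \<delta>))"
      by (rule mult_right_mono[OF ge]) simp
    also have "\<dots> = norm (dseries (\<lambda>n. \<xi> n * of_real (ln n)) (1 + \<delta>))"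
      using \<delta>(1) by (subst dseries_char_ln_eq[OF N0 \<xi>(1)]) (auto simp: norm_mult)
    also have "\<dots> \<le> C" using C \<delta>(1) by simp
    finally show ?case using l by (simp add: field_simps)
  qed
  thus ?thesis by blast
qed

section \<open>Primes in arithmetic progressions\<close>

text \<open>For the power \<open>p ^ (k + 2)\<close>, the bound
  \<open>ln p \<le> 2 * p powr (1/2)\<close> gives the majorant
  \<open>2 * p powr (-3/2) * (1/2) ^ k\<close>, summable in \<open>p\<close> and \<open>k\<close>
  independently.\<close>

lemma prime_power_series_summable:
  "(\<lambda>n. mangoldt n / real n) summable_on {n. primepow n \<and> \<not> prime n}"
proof -
  let ?h = "\<lambda>(p, k). p ^ Suc (Suc k) :: nat"
  have "{n :: nat. primepow n \<and> \<not> prime n} \<subseteq> ?h ` (Collect prime \<times> UNIV)"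
  proof
    fix n :: nat assume "n \<in> {n. primepow n \<and> \<not> prime n}"
    then obtain p k where pk: "prime p" "k > 0" "n = p ^ k" "\<not> prime n"
      unfolding primepow_def by blast
    hence "k \<noteq> 1" by auto
    then obtain j where "k = Suc (Suc j)" using \<open>k > 0\<close> by (metis One_nat_def not0_implies_Suc less_numeral_extra(3))
    thus "n \<in> ?h ` (Collect prime \<times> UNIV)" using pk by (auto intro!: image_eqI[of _ _ "(p, j)"])
  qed
  moreover have "(\<lambda>n. mangoldt n / real n) summable_on ?h ` (Collect prime \<times> UNIV)"
  proof (subst summable_on_reindex)
    show "inj_on ?h (Collect prime \<times> UNIV)"
    proof (rule inj_onI, clarify)
      fix p q k l :: nat assume "prime p" "prime q" "p ^ Suc (Suc k) = q ^ Suc (Suc l)"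
      thus "p = q \<and> k = l"
        using inj_onD[OF bij_betw_imp_inj_on[OF bij_betw_primepows], of "(p, Suc k)" "(q, Suc l)"] by auto
    qed
    have "summable (\<lambda>p. 2 * real p powr (-3/2))"
      by (intro summable_mult) (simp add: summable_real_powr_iff)
    hence s1: "(\<lambda>p. 2 * real p powr (-3/2)) summable_on Collect prime"
      by (intro summable_on_subset[OF summable_nonneg_imp_summable_on]) auto
    have s2: "(\<lambda>k. (1/2) ^ k :: real) summable_on UNIV"
      by (intro summable_nonneg_imp_summable_on) (auto intro: summable_geometric)
    have "(\<lambda>(p, k). 2 * real p powr (-3/2) * (1/2) ^ k) abs_summable_on (Collect prime \<times> UNIV)"
      unfolding abs_summable_on_Sigma_iff
    proof (intro conjI ballI)
      show "(\<lambda>k. case (p, k) of (p, k) \<Rightarrow> 2 * real p powr (-3/2) * (1/2) ^ k) abs_summable_on UNIV" for p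
        using summable_on_cmult_right[OF s2, of "2 * real p powr (-3/2)"] by (simp add: abs_mult)
      have "(\<lambda>p. 2 * real p powr (-3/2) * infsum (\<lambda>k. (1/2) ^ k :: real) UNIV) summable_on Collect prime"
        by (rule summable_on_cmult_left[OF s1])
      moreover have "infsum (\<lambda>k. norm (case (p, k) of (p, k) \<Rightarrow> 2 * real p powr (-3/2) * (1/2) ^ k)) UNIV =
             2 * real p powr (-3/2) * infsum (\<lambda>k. (1/2) ^ k :: real) UNIV" for p :: nat
        by (simp add: abs_mult infsum_cmult_right')
      ultimately show "(\<lambda>p. infsum (\<lambda>k. norm (case (p, k) of (p, k) \<Rightarrow> 2 * real p powr (-3/2) * (1/2) ^ k)) UNIV)
          abs_summable_on Collect prime"
        by (simp only: summable_on_iff_abs_summable_on_real[symmetric])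
    qed
    hence "(\<lambda>(p, k). 2 * real p powr (-3/2) * (1/2) ^ k) summable_on (Collect prime \<times> UNIV)"
      by (simp only: summable_on_iff_abs_summable_on_real[symmetric])
    thus "((\<lambda>n. mangoldt n / real n) \<circ> ?h) summable_on (Collect prime \<times> UNIV)"
    proof (rule summable_on_comparison_test)
      fix z :: "nat \<times> nat" assume "z \<in> Collect prime \<times> UNIV"
      then obtain p k where z: "z = (p, k)" "prime p" by auto
      have p: "real p \<ge> 2" using prime_ge_2_nat[OF z(2)] by simp
      have m: "mangoldt (p ^ Suc (Suc k)) = ln (real p)"
        using mangoldt_primepow'[OF z(2), of "Suc (Suc k)", where ?'a = real] by simp
      have "ln (real p) \<le> real p powr (1/2) / (1/2)" using p by (intro ln_powr_bound) auto
      moreover have "(1 / real p) ^ k \<le> (1/2) ^ k" using p by (intro power_mono) (auto simp: field_simps)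
      moreover have "ln (real p) \<ge> 0" using p by simp
      ultimately have "ln (real p) * (1 / real p) ^ 2 * (1 / real p) ^ k \<le>
                       (2 * real p powr (1/2)) * (1 / real p) ^ 2 * (1/2) ^ k"
        using p by (intro mult_mono) auto
      moreover have "real p powr (1/2) * (1 / real p) ^ 2 = real p powr (-3/2)"
      proof -
        have "(1 / real p) ^ 2 = real p powr (-2)"
          using p by (simp add: powr_minus_divide power_divide)
        thus ?thesis by (simp flip: powr_add)
      qed
      moreover have "ln (real p) / real (p ^ Suc (Suc k)) = ln (real p) * (1 / real p) ^ 2 * (1 / real p) ^ k"
        by (simp add: power2_eq_square power_divide)
      ultimately show "((\<lambda>n. mangoldt n / real n) \<circ> ?h) z \<le> (case z of (p, k) \<Rightarrow> 2 * real p powr (-3/2) * (1/2) ^ k)"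
        unfolding z(1) o_apply prod.case m by (simp only: mult.assoc)
      show "0 \<le> ((\<lambda>n. mangoldt n / real n) \<circ> ?h) z"
        by (auto simp: mangoldt_nonneg split: prod.splits)
    qed
  qed
  ultimately show ?thesis using summable_on_subset by blast
qed

text \<open>The terms \<open>n = 1 + N * j\<close> alone diverge at \<open>s = 1\<close> by
  comparison with the harmonic series. Finitely many of them already exceed \<open>K\<close>, and a
  finite sum is continuous in \<open>\<delta>\<close>.\<close>

lemma dseries_principal_at_top:
  assumes N: "N > 0"
  shows "\<forall>\<^sub>F \<delta> in at_right 0. Re (dseries (principal_char N) (1 + \<delta>)) \<ge> K"
proof -
  have "\<exists>J. (\<Sum>j<J. 1 / real (1 + N * j)) > K"
  proof (rule ccontr)
    assume "\<not> ?thesis"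
    hence "\<And>J. (\<Sum>j<J. 1 / real (1 + N * j)) \<le> K" by (simp add: not_less)
    hence "summable (\<lambda>j. 1 / real (1 + N * j))"
      by (intro summableI_nonneg_bounded) auto
    hence "summable (\<lambda>j. real N * (1 / real (1 + N * j)))" by (rule summable_mult)
    hence "summable (\<lambda>j. inverse (real (Suc j)))"
    proof (rule summable_comparison_test'[of _ 0])
      fix j :: nat
      have "real (1 + N * j) \<le> real (N * Suc j)" using N by (intro of_nat_mono) simp
      hence "real N * (1 / real (1 + N * j)) \<ge> real N * (1 / real (N * Suc j))"
        by (intro mult_left_mono divide_left_mono mult_pos_pos of_nat_0_less_iff[THEN iffD2]) (use N in auto)
      moreover have "real N * (1 / real (N * Suc j)) = inverse (real (Suc j))"
        using N by (simp add: inverse_eq_divide del: of_nat_Suc mult_Suc_right)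
      ultimately show "norm (inverse (real (Suc j))) \<le> real N * (1 / real (1 + N * j))" by simp
    qed
    thus False using not_summable_harmonic[where ?'a = real] by (subst (asm) summable_Suc_iff) simp
  qed
  then obtain J where J: "(\<Sum>j<J. 1 / real (1 + N * j)) > K" by blast
  have "((\<lambda>\<delta>. \<Sum>j<J. real (1 + N * j) powr -(1 + \<delta>)) \<longlongrightarrow> (\<Sum>j<J. real (1 + N * j) powr -(1 + 0))) (at_right 0)"
    by (intro tendsto_intros) (simp_all del: of_nat_add of_nat_mult of_nat_Suc)
  moreover have "(\<Sum>j<J. real (1 + N * j) powr -(1 + 0)) = (\<Sum>j<J. 1 / real (1 + N * j))"
    by (intro sum.cong refl) (simp add: powr_minus_divide del: of_nat_add)
  ultimately have "\<forall>\<^sub>F \<delta> in at_right 0. (\<Sum>j<J. real (1 + N * j) powr -(1 + \<delta>)) > K"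
    using J by (metis order_tendstoD(1))
  moreover have "\<forall>\<^sub>F \<delta>::real in at_right 0. \<delta> > 0" by (simp add: eventually_at_right_less)
  ultimately show ?thesis
  proof eventually_elim
    case (elim \<delta>)
    let ?t = "\<lambda>n. Re (dterm (principal_char N) (1 + \<delta>) n)"
    have sm: "dterm (principal_char N) (1 + \<delta>) abs_summable_on {1..}"
      using dterm_residue_char_abs_summable[OF N residue_char_principal] elim by simp
    have "inj_on (\<lambda>j. 1 + N * j) {..<J}" using N by (intro inj_onI) simp
    hence "(\<Sum>n\<in>(\<lambda>j. 1 + N * j) ` {..<J}. ?t n) = (\<Sum>j<J. ?t (1 + N * j))"
      by (simp only: sum.reindex o_def)
    also have "\<dots> = (\<Sum>j<J. real (1 + N * j) powr -(1 + \<delta>))"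
    proof (intro sum.cong refl)
      fix j
      have "coprime (1 + N * j) N"
        by (metis add.commute coprime_1_left coprime_iff_gcd_eq_1 gcd.commute gcd_add_mult mult.commute)
      thus "?t (1 + N * j) = real (1 + N * j) powr -(1 + \<delta>)" by (simp add: dterm_def principal_char_def)
    qed
    finally have "K < (\<Sum>n\<in>(\<lambda>j. 1 + N * j) ` {..<J}. ?t n)" using elim by simp
    also have "\<dots> \<le> (\<Sum>\<^sub>\<infinity>n\<in>{1..}. ?t n)"
      by (rule finite_sum_le_infsum[OF summable_on_Re[OF abs_summable_summable[OF sm]]])
         (auto simp: dterm_def principal_char_def)
    also have "\<dots> = Re (dseries (principal_char N) (1 + \<delta>))"
      unfolding dseries_def by (rule infsum_Re[OF abs_summable_summable[OF sm]])
    finally show ?case by simp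
  qed
qed

text \<open>Beyond \<open>M\<close> the weight is at least \<open>ln M\<close>, while each of the
  first \<open>M\<close> terms costs at most \<open>ln M\<close>. Since \<open>M\<close> is free,
  the weighted series outgrows every multiple of the unweighted one.\<close>

lemma dseries_principal_ln_ge:
  assumes N: "N > 0" and s: "s > 1" and M: "M > 0"
  shows "Re (dseries (\<lambda>n. principal_char N n * of_real (ln n)) s) \<ge>
         ln (real M) * (Re (dseries (principal_char N) s) - real M)"
proof -
  have sm: "dterm (principal_char N) s abs_summable_on {1..}"
    using dterm_residue_char_abs_summable[OF N residue_char_principal s] .
  have sml: "dterm (\<lambda>n. principal_char N n * of_real (ln n)) s abs_summable_on {1..}"
    by (rule dterm_abs_summable[OF s]) (auto simp: principal_char_def)
  define f where "f n = Re (dterm (principal_char N) s n)" for n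
  define g where "g n = Re (dterm (\<lambda>n. principal_char N n * of_real (ln n)) s n)" for n
  have f: "(f has_sum Re (dseries (principal_char N) s)) {1..}"
    unfolding f_def dseries_def by (rule has_sum_Re[OF has_sum_infsum[OF abs_summable_summable[OF sm]]])
  have g: "(g has_sum Re (dseries (\<lambda>n. principal_char N n * of_real (ln n)) s)) {1..}"
    unfolding g_def dseries_def by (rule has_sum_Re[OF has_sum_infsum[OF abs_summable_summable[OF sml]]])
  have h: "((\<lambda>n. if n \<le> M then - ln (real M) else 0) has_sum (- ln (real M) * M)) {1..}"
    by (rule has_sum_finite_neutralI[of "{1..M}"]) auto
  have "ln (real M) * Re (dseries (principal_char N) s) + (- ln (real M) * M) \<le>
        Re (dseries (\<lambda>n. principal_char N n * of_real (ln n)) s)"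
  proof (rule has_sum_mono[OF has_sum_add[OF has_sum_cmult_right[OF f, of "ln (real M)"] h] g])
    fix n :: nat assume "n \<in> {1..}"
    hence n: "n \<ge> 1" by simp
    have gf: "g n = ln n * f n" by (simp add: g_def f_def dterm_def)
    have "real n powr -s \<le> real n powr 0" using n s by (intro powr_mono) auto
    hence f01: "0 \<le> f n" "f n \<le> 1" using n by (auto simp: f_def dterm_def principal_char_def)
    have lnM: "ln (real M) \<ge> 0" "ln (real n) \<ge> 0" using M n by simp_all
    show "ln (real M) * f n + (if n \<le> M then - ln (real M) else 0) \<le> g n"
    proof (cases "n \<le> M")
      case True
      have "ln (real M) * f n \<le> ln (real M) * 1" using f01 lnM by (intro mult_left_mono)
      moreover have "0 \<le> ln n * f n" using f01 lnM by simp
      ultimately show ?thesis using True gf by simp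
    next
      case False
      hence "ln (real M) \<le> ln (real n)" using M by simp
      thus ?thesis using False gf f01 by (simp add: mult_right_mono)
    qed
  qed
  thus ?thesis by (simp add: algebra_simps)
qed

lemma dseries_principal_mangoldt_at_top:
  assumes N: "N > 0"
  shows "\<forall>\<^sub>F \<delta> in at_right 0. norm (dseries (\<lambda>n. principal_char N n * mangoldt n) (1 + \<delta>)) \<ge> K"
proof -
  \<comment> \<open>Chosen so that \<open>ln M \<ge> 2 * \<bar>K\<bar>\<close>. Once
    \<open>Z \<ge> 2 * M\<close>, the quantity \<open>Z - M\<close> is at least
    \<open>Z / 2\<close>, and \<open>ln M * (Z - M) \<ge> \<bar>K\<bar> * Z\<close> can be divided
    by \<open>Z\<close>.\<close>
  define M :: nat where "M = nat \<lceil>exp (2 * \<bar>K\<bar>)\<rceil>"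
  have ge: "real M \<ge> exp (2 * \<bar>K\<bar>)" by (simp add: M_def)
  hence M0: "real M > 0" using exp_gt_zero[of "2 * \<bar>K\<bar>"] by linarith
  hence M: "M > 0" "ln (real M) \<ge> 2 * \<bar>K\<bar>"
    using ge by (simp_all only: ln_ge_iff of_nat_0_less_iff)
  have "\<forall>\<^sub>F \<delta> in at_right 0. Re (dseries (principal_char N) (1 + \<delta>)) \<ge> 2 * real M"
    by (rule dseries_principal_at_top[OF N])
  moreover have "\<forall>\<^sub>F \<delta>::real in at_right 0. \<delta> > 0" by (simp add: eventually_at_right_less)
  ultimately show ?thesis
  proof eventually_elim
    case (elim \<delta>)
    define Z where "Z = Re (dseries (principal_char N) (1 + \<delta>))"
    have Z: "Z \<ge> 2 * real M" "Z > 0" using elim M by (auto simp: Z_def)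
    have sm: "dterm (principal_char N) (1 + \<delta>) abs_summable_on {1..}"
      using dterm_residue_char_abs_summable[OF N residue_char_principal] elim by simp
    have "Im (dseries (principal_char N) (1 + \<delta>)) = 0"
    proof -
      have "Im (dseries (principal_char N) (1 + \<delta>)) = (\<Sum>\<^sub>\<infinity>n\<in>{1..}. Im (dterm (principal_char N) (1 + \<delta>) n))"
        unfolding dseries_def by (rule infsum_Im[OF abs_summable_summable[OF sm], symmetric])
      also have "\<dots> = 0" by (rule infsum_0) (simp add: dterm_def principal_char_def)
      finally show ?thesis .
    qed
    hence nZ: "norm (dseries (principal_char N) (1 + \<delta>)) = Z" using Z(2) by (simp add: cmod_eq_Re Z_def)
    define W where "W = norm (dseries (\<lambda>n. principal_char N n * mangoldt n) (1 + \<delta>))"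
    have "Z * \<bar>K\<bar> \<le> 2 * \<bar>K\<bar> * (Z - real M)"
      using mult_right_mono[OF Z(1), of "\<bar>K\<bar>"] by (simp add: algebra_simps)
    also have "\<dots> \<le> ln (real M) * (Z - real M)"
      using M(2) Z by (intro mult_right_mono) auto
    also have "\<dots> \<le> Re (dseries (\<lambda>n. principal_char N n * of_real (ln n)) (1 + \<delta>))"
      unfolding Z_def using elim M by (intro dseries_principal_ln_ge[OF N]) auto
    also have "\<dots> \<le> norm (dseries (\<lambda>n. principal_char N n * of_real (ln n)) (1 + \<delta>))"
      by (rule complex_Re_le_cmod)
    also have "\<dots> = Z * W"
      using dseries_char_ln_eq[OF N residue_char_principal, of "1 + \<delta>"] elim
      by (simp add: norm_mult nZ W_def)
    finally have "\<bar>K\<bar> \<le> W" using Z(2) by simp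
    thus ?case by (simp add: W_def)
  qed
qed

lemma dseries_sum:
  assumes "\<And>i. i \<in> I \<Longrightarrow> dterm (f i) s abs_summable_on {1..}"
    and "dterm (\<lambda>n. \<Sum>i\<in>I. c i * f i n) s abs_summable_on {1..}"
  shows "dseries (\<lambda>n. \<Sum>i\<in>I. c i * f i n) s = (\<Sum>i\<in>I. c i * dseries (f i) s)"
proof -
  have "(\<lambda>n. \<Sum>i\<in>I. c i * dterm (f i) s n) sums (\<Sum>i\<in>I. c i * dseries (f i) s)"
    by (intro sums_sum sums_mult dterm_sums assms)
  also have "(\<lambda>n. \<Sum>i\<in>I. c i * dterm (f i) s n) = dterm (\<lambda>n. \<Sum>i\<in>I. c i * f i n) s"
    by (simp add: dterm_def fun_eq_iff sum_distrib_right mult.assoc)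
  finally show ?thesis using dterm_sums[OF assms(2)] sums_unique2 by blast
qed

lemma dterm_mangoldt_class_abs_summable:
  assumes "s > 1"
  shows "dterm (\<lambda>n. if [n = a] (mod N) then mangoldt n else 0) s abs_summable_on {1..}"
proof (rule dterm_abs_summable[OF assms])
  fix n :: nat assume n: "n > 0"
  have "ln (real n) \<ge> 0" using n by simp
  thus "norm (if [n = a] (mod N) then mangoldt n else 0 :: complex) \<le> 1 + ln n"
    using mangoldt_le[OF n] by simp
qed

text \<open>The majorant \<open>u\<close> is free of \<open>s\<close>: the finitely many primes in
  the class contribute \<open>ln n\<close>, and the higher prime powers form a convergent series at
  \<open>s = 1\<close>.\<close>

lemma dseries_mangoldt_class_bounded:
  assumes fin: "finite {p. prime p \<and> [p = a] (mod N)}"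
  shows "\<exists>C. \<forall>s>1. norm (dseries (\<lambda>n. if [n = a] (mod N) then mangoldt n else 0) s) \<le> C"
proof -
  define Q where "Q = {p. prime p \<and> [p = a] (mod N)}"
  define R where "R = {n :: nat. primepow n \<and> \<not> prime n}"
  define u where "u n = (if n \<in> Q then ln (real n) else 0) + (if n \<in> R then mangoldt n / real n else 0)" for n
  have "(\<lambda>n. if n \<in> Q then ln (real n) else 0) summable_on {1..}"
    using fin by (intro finite_nonzero_values_imp_summable_on) (auto simp: Q_def elim: finite_subset[rotated])
  moreover have "(\<lambda>n. if n \<in> R then mangoldt n / real n else 0) summable_on {1..}"
  proof -
    have "(\<lambda>n. mangoldt n / real n) summable_on R" unfolding R_def by (rule prime_power_series_summable)
    also have "?this \<longleftrightarrow> ?thesis"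
      by (rule summable_on_cong_neutral) (auto simp: R_def Suc_le_eq dest: primepow_gt_0_nat)
    finally show ?thesis .
  qed
  ultimately have "u summable_on {1..}" unfolding u_def by (rule summable_on_add)
  hence u: "(u has_sum infsum u {1..}) {1..}" by (rule has_sum_infsum)
  have "norm (dseries (\<lambda>n. if [n = a] (mod N) then mangoldt n else 0) s) \<le> infsum u {1..}" if s: "s > 1" for s
  proof (rule norm_infsum_le[OF _ u])
    let ?f = "\<lambda>n. if [n = a] (mod N) then mangoldt n else 0 :: complex"
    show "(dterm ?f s has_sum dseries ?f s) {1..}"
      unfolding dseries_def
      by (rule has_sum_infsum[OF abs_summable_summable[OF dterm_mangoldt_class_abs_summable[OF s]]])
    fix n :: nat assume "n \<in> {1..}"
    hence n: "n \<ge> 1" by simp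
    have pw: "real n powr -s \<le> 1 / real n"
    proof -
      have "real n powr -s \<le> real n powr -1" using n s by (intro powr_mono) auto
      thus ?thesis using n by (simp add: powr_minus_divide)
    qed
    have pw1: "1 / real n \<le> 1" using n by simp
    have nn: "mangoldt n \<ge> (0 :: real)" "ln (real n) \<ge> 0" using n by (simp_all add: mangoldt_nonneg)
    consider "\<not> [n = a] (mod N)" | "\<not> primepow n" | "[n = a] (mod N)" "prime n" | "n \<in> R"
      by (auto simp: R_def)
    thus "norm (dterm ?f s n) \<le> u n"
    proof cases
      case 1
      thus ?thesis using nn by (simp add: dterm_def u_def)
    next
      case 2
      thus ?thesis using nn by (simp add: dterm_def u_def mangoldt_def)
    next
      case 3
      hence "n \<in> Q" "n \<notin> R" by (auto simp: Q_def R_def)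
      moreover have "norm (dterm ?f s n) = ln (real n) * real n powr -s"
        using 3 nn by (simp add: dterm_def norm_mult)
      moreover have "ln (real n) * real n powr -s \<le> ln (real n) * 1"
        using pw pw1 nn by (intro mult_left_mono) auto
      ultimately show ?thesis by (simp add: u_def)
    next
      case 4
      have "norm (dterm ?f s n) \<le> mangoldt n * real n powr -s"
        using nn by (simp add: dterm_def norm_mult)
      also have "\<dots> \<le> mangoldt n * (1 / real n)" by (rule mult_left_mono[OF pw nn(1)])
      also have "\<dots> \<le> u n" using 4 nn by (simp add: u_def)
      finally show ?thesis .
    qed
  qed
  thus ?thesis by blast
qed

text \<open>Orthogonality writes \<open>card X\<close> times the series of the class of
  \<open>a\<close> as a combination of the logarithmic derivatives. Only the principal one is
  unbounded near 1, so the class series cannot stay bounded.\<close>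

theorem Dirichlet_primes:
  fixes a N :: nat
  assumes "N > 0" "coprime a N"
  shows "infinite {p. prime p \<and> [p = a] (mod N)}"
proof (cases "N = 1")
  case True
  thus ?thesis using primes_infinite by simp
next
  case False
  hence N: "N > 1" and N0: "N > 0" using assms(1) by auto
  show ?thesis
  proof
    assume fin: "finite {p. prime p \<and> [p = a] (mod N)}"
    define X where "X = {\<xi>. residue_char N \<xi>}"
    define Y where "Y = X - {principal_char N}"
    define G where "G \<xi> s = dseries (\<lambda>n. \<xi> n * mangoldt n) s" for \<xi> s
    have finX: "finite X" unfolding X_def by (rule finite_residue_chars[OF N0])
    have X: "X = insert (principal_char N) Y" "principal_char N \<notin> Y" "finite Y"
      using residue_char_principal finX by (auto simp: X_def Y_def)
    obtain C where C: "\<And>s. s > 1 \<Longrightarrow> norm (dseries (\<lambda>n. if [n = a] (mod N) then mangoldt n else 0) s) \<le> C"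
      using dseries_mangoldt_class_bounded[OF fin] by blast
    have "\<forall>\<xi>\<in>Y. \<exists>K. \<forall>\<^sub>F \<delta> in at_right 0. norm (G \<xi> (1 + \<delta>)) \<le> K"
      using dseries_char_mangoldt_bounded[OF N] unfolding Y_def X_def G_def by blast
    then obtain K where K: "\<And>\<xi>. \<xi> \<in> Y \<Longrightarrow> \<forall>\<^sub>F \<delta> in at_right 0. norm (G \<xi> (1 + \<delta>)) \<le> K \<xi>"
      by metis
    define B where "B = real (card X) * C + (\<Sum>\<xi>\<in>Y. K \<xi>)"
    have "\<forall>\<^sub>F \<delta> in at_right 0. \<forall>\<xi>\<in>Y. norm (G \<xi> (1 + \<delta>)) \<le> K \<xi>"
      using K X(3) by (simp add: eventually_ball_finite)
    moreover have "\<forall>\<^sub>F \<delta> in at_right 0. norm (G (principal_char N) (1 + \<delta>)) \<ge> B + 1"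
      unfolding G_def by (rule dseries_principal_mangoldt_at_top[OF N0])
    moreover have "\<forall>\<^sub>F \<delta>::real in at_right 0. \<delta> > 0" by (simp add: eventually_at_right_less)
    ultimately have "\<forall>\<^sub>F \<delta>::real in at_right 0. False"
    proof eventually_elim
      case (elim \<delta>)
      define s where "s = 1 + \<delta>"
      have s: "s > 1" using elim by (simp add: s_def)
      define D where "D = dseries (\<lambda>n. if [n = a] (mod N) then mangoldt n else 0) s"
      have abs: "dterm (\<lambda>n. of_nat (card X) * (if [n = a] (mod N) then mangoldt n else 0)) s abs_summable_on {1..}"
        "dseries (\<lambda>n. of_nat (card X) * (if [n = a] (mod N) then mangoldt n else 0)) s = of_nat (card X) * D"
      proof -
        from summable_on_cmult_right[OF dterm_mangoldt_class_abs_summable[OF s], of "real (card X)"]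
        show "dterm (\<lambda>n. of_nat (card X) * (if [n = a] (mod N) then mangoldt n else 0)) s abs_summable_on {1..}"
          by (simp add: dterm_def norm_mult mult.assoc)
        show "dseries (\<lambda>n. of_nat (card X) * (if [n = a] (mod N) then mangoldt n else 0)) s = of_nat (card X) * D"
          by (simp add: D_def dseries_def dterm_def mult.assoc infsum_cmult_right')
      qed
      have fn: "(\<lambda>n. \<Sum>\<xi>\<in>X. cnj (\<xi> a) * (\<xi> n * mangoldt n)) =
            (\<lambda>n. of_nat (card X) * (if [n = a] (mod N) then mangoldt n else 0))"
      proof
        fix n
        have "(\<Sum>\<xi>\<in>X. cnj (\<xi> a) * (\<xi> n * mangoldt n)) = (\<Sum>\<xi>\<in>X. \<xi> n * cnj (\<xi> a)) * mangoldt n"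
          unfolding sum_distrib_right by (intro sum.cong refl) (simp add: mult_ac)
        thus "(\<Sum>\<xi>\<in>X. cnj (\<xi> a) * (\<xi> n * mangoldt n)) =
              of_nat (card X) * (if [n = a] (mod N) then mangoldt n else 0)"
          unfolding X_def sum_residue_chars_mult_cnj[OF N0 assms(2)] by simp
      qed
      have "(\<Sum>\<xi>\<in>X. cnj (\<xi> a) * G \<xi> s) = dseries (\<lambda>n. \<Sum>\<xi>\<in>X. cnj (\<xi> a) * (\<xi> n * mangoldt n)) s"
        unfolding G_def
      proof (rule dseries_sum[symmetric])
        show "dterm (\<lambda>n. \<xi> n * mangoldt n) s abs_summable_on {1..}" if "\<xi> \<in> X" for \<xi>
          using that dterm_char_mangoldt_abs_summable[OF N0 _ s] by (simp add: X_def)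
      qed (unfold fn, rule abs(1))
      also have "\<dots> = of_nat (card X) * D" unfolding fn by (rule abs(2))
      finally have "cnj (principal_char N a) * G (principal_char N) s + (\<Sum>\<xi>\<in>Y. cnj (\<xi> a) * G \<xi> s) = of_nat (card X) * D"
        using X by simp
      hence "G (principal_char N) s = of_nat (card X) * D - (\<Sum>\<xi>\<in>Y. cnj (\<xi> a) * G \<xi> s)"
        using assms(2) by (simp add: principal_char_def algebra_simps)
      hence "norm (G (principal_char N) s) \<le> norm (of_nat (card X) * D) + norm (\<Sum>\<xi>\<in>Y. cnj (\<xi> a) * G \<xi> s)"
        by (metis norm_triangle_ineq4)
      also have "norm (of_nat (card X) * D) \<le> real (card X) * C"
        using C[OF s] by (simp add: norm_mult D_def mult_left_mono)
      also have "norm (\<Sum>\<xi>\<in>Y. cnj (\<xi> a) * G \<xi> s) \<le> (\<Sum>\<xi>\<in>Y. K \<xi>)"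
      proof (intro order_trans[OF norm_sum] sum_mono)
        fix \<xi> assume \<xi>: "\<xi> \<in> Y"
        hence "norm (cnj (\<xi> a)) = 1"
          using norm_residue_char[OF _ assms(2) N0] by (simp add: Y_def X_def)
        thus "norm (cnj (\<xi> a) * G \<xi> s) \<le> K \<xi>" using elim(1) \<xi> by (simp add: norm_mult s_def)
      qed
      finally show False using elim(2) by (simp add: B_def s_def)
    qed
    thus False by (simp add: eventually_False)
  qed
qed

section \<open>Congruences for totients\<close>

text \<open>Here \<open>y\<close> stands for \<open>x - 1\<close>, which keeps truncated subtraction
  away. The lifting is a fixed-point iteration: \<open>y\<close> is replaced by \<open>t\<close>
  divided by \<open>(y + 1) ^ j\<close>, which gains one power of \<open>p\<close> because
  \<open>p\<close> divides \<open>t\<close>.\<close>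

lemma exists_shifted_power_cong_prime_power:
  fixes p t j e :: nat
  assumes p: "prime p" and t: "p dvd t"
  shows "\<exists>y. p dvd y \<and> [y * (y + 1) ^ j = t] (mod p ^ e)"
proof (induction e)
  case 0
  show ?case by (intro exI[of _ 0]) auto
next
  case (Suc e)
  then obtain y where y: "p dvd y" "[y * (y + 1) ^ j = t] (mod p ^ e)" by blast
  have "\<not> p dvd y + 1"
    using p y(1) by (metis dvd_add_right_iff not_prime_unit)
  hence "coprime ((y + 1) ^ j) (p ^ Suc e)"
    using p prime_imp_coprime coprime_commute coprime_power_left_iff coprime_power_right_iff by blast
  then obtain u where u: "[(y + 1) ^ j * u = 1] (mod p ^ Suc e)"
    using cong_solve_coprime_nat by fastforce
  hence u': "[(y + 1) ^ j * u = 1] (mod p ^ e)"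
    by (rule cong_dvd_modulus_nat) auto
  define y' where "y' = t * u"
  have "[y' = y * (y + 1) ^ j * u] (mod p ^ e)"
    unfolding y'_def using y(2) by (intro cong_mult cong_refl) (simp add: cong_sym)
  also have "[y * (y + 1) ^ j * u = y * 1] (mod p ^ e)"
    unfolding mult.assoc using u' by (intro cong_mult cong_refl)
  finally have "[(y' + 1) ^ j = (y + 1) ^ j] (mod p ^ e)"
    by (intro cong_pow cong_add cong_refl) simp
  hence "int (p ^ e) dvd int ((y' + 1) ^ j) - int ((y + 1) ^ j)"
    by (metis cong_iff_dvd_diff cong_int_iff)
  \<comment> \<open>This factor \<open>p\<close>, times the agreement of the \<open>j\<close>-th
    powers modulo \<open>p ^ e\<close>, yields the congruence modulo
    \<open>p ^ Suc e\<close>.\<close>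
  moreover have py': "p dvd y'" using t by (simp add: y'_def)
  ultimately have "int p * int (p ^ e) dvd int y' * (int ((y' + 1) ^ j) - int ((y + 1) ^ j))"
    by (intro mult_dvd_mono) (simp_all only: int_dvd_int_iff)
  hence "[int (y' * (y' + 1) ^ j) = int (y' * (y + 1) ^ j)] (mod int (p ^ Suc e))"
    by (simp add: cong_iff_dvd_diff algebra_simps)
  hence "[y' * (y' + 1) ^ j = y' * (y + 1) ^ j] (mod p ^ Suc e)"
    by (simp only: cong_int_iff)
  also have "y' * (y + 1) ^ j = t * ((y + 1) ^ j * u)"
    by (simp add: y'_def)
  also have "[t * ((y + 1) ^ j * u) = t * 1] (mod p ^ Suc e)"
    using u by (intro cong_mult cong_refl)
  finally show ?case using py' by auto
qed

lemma prime_power_coprime_decomposition: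
  fixes p n :: nat
  assumes "prime p" "n > 0"
  obtains e r where "n = p ^ e * r" "coprime p r" "r > 0"
proof -
  obtain r where "n = p ^ multiplicity p n * r" "\<not> p dvd r"
    using multiplicity_decompose'[of n p] assms
    by (metis less_numeral_extra(3) not_prime_unit)
  thus ?thesis using assms that prime_imp_coprime
    by (metis gr0I mult_0_right)
qed

lemma exists_shifted_power_cong:
  fixes p j M :: nat
  assumes p: "prime p" and j: "j > 0" and M: "M > 0"
  shows "\<exists>y. coprime (y + 1) M \<and> [y * (y + 1) ^ j = (p - 1) * p ^ j] (mod M)"
proof -
  obtain e R where R: "M = p ^ e * R" "coprime p R" "R > 0"
    using prime_power_coprime_decomposition p M by metis
  have "p dvd (p - 1) * p ^ j" using j by simp
  then obtain y1 where y1: "p dvd y1" "[y1 * (y1 + 1) ^ j = (p - 1) * p ^ j] (mod p ^ e)"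
    using exists_shifted_power_cong_prime_power[OF p] by blast
  obtain y where y: "[y = y1] (mod p ^ e)" "[y = p - 1] (mod R)"
    using binary_chinese_remainder_nat R(2) coprime_power_left_iff by metis
  have y': "[y + 1 = y1 + 1] (mod p ^ e)" "[y + 1 = p] (mod R)"
    using cong_add[OF y(1) cong_refl[of 1]] cong_add[OF y(2) cong_refl[of 1]]
      prime_gt_0_nat[OF p] by simp_all
  have "coprime (y1 + 1) p"
    using p y1(1) by (metis dvd_add_right_iff not_prime_unit prime_imp_coprime coprime_commute)
  hence "coprime (y + 1) (p ^ e)"
    by (rule cong_imp_coprime[OF cong_sym[OF y'(1)] coprime_power_right_iff[THEN iffD2, OF disjI1]])
  moreover have "coprime (y + 1) R"
    by (rule cong_imp_coprime[OF cong_sym[OF y'(2)] R(2)])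
  ultimately have "coprime (y + 1) M" by (simp add: R(1))
  moreover have "[y * (y + 1) ^ j = (p - 1) * p ^ j] (mod p ^ e * R)"
  proof (rule coprime_cong_mult_nat)
    have "[y * (y + 1) ^ j = y1 * (y1 + 1) ^ j] (mod p ^ e)"
      using y(1) y'(1) by (intro cong_mult cong_pow)
    thus "[y * (y + 1) ^ j = (p - 1) * p ^ j] (mod p ^ e)" using y1(2) cong_trans by blast
    show "[y * (y + 1) ^ j = (p - 1) * p ^ j] (mod R)"
      using y(2) y'(2) by (intro cong_mult cong_pow)
  qed (use R(2) in simp)
  ultimately show ?thesis using R(1) by auto
qed

text \<open>The choice \<open>y = 1\<close>, \<open>z = w\<close> gives the shifted values 2 and
  \<open>w + 1\<close>, and fails only if \<open>r\<close> divides \<open>w + 1\<close>. Then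
  \<open>y = 2\<close>, \<open>z = w / 2\<close> works: \<open>y + 1 = 3\<close> is a unit as
  \<open>r \<ge> 5\<close>, and \<open>2 * (z + 1) = w + 2\<close> is 1 modulo
  \<open>r\<close>.\<close>

lemma exists_shifted_product_cong_prime_power:
  fixes r w e :: nat
  assumes r: "prime r" "r \<ge> 5"
  shows "\<exists>y z. coprime (y + 1) (r ^ e) \<and> coprime (z + 1) (r ^ e) \<and> [y * z = w] (mod r ^ e)"
proof (cases "r dvd w + 1")
  case False
  have "\<not> r dvd 2" using r by (auto dest: dvd_imp_le)
  hence "coprime (1 + 1) (r ^ e)" "coprime (w + 1) (r ^ e)"
    using r False prime_imp_coprime coprime_commute coprime_power_right_iff one_add_one by metis+
  thus ?thesis by (intro exI[of _ 1] exI[of _ w]) auto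
next
  case True
  have "\<not> r dvd 2" "\<not> r dvd 3" using r by (auto dest: dvd_imp_le)
  \<comment> \<open>The modulus is raised by one power so that the congruence for \<open>z\<close>
    can be reduced modulo \<open>r\<close> even when \<open>e = 0\<close>.\<close>
  hence "coprime 2 (r ^ Suc e)" and 3: "coprime 3 (r ^ e)"
    using r prime_imp_coprime coprime_commute coprime_power_right_iff by blast+
  then obtain u where u: "[2 * u = 1] (mod r ^ Suc e)"
    using cong_solve_coprime_nat by fastforce
  define z where "z = w * u"
  have "[w * (2 * u) = w * 1] (mod r ^ Suc e)" using u by (intro cong_mult cong_refl)
  hence z: "[2 * z = w] (mod r ^ Suc e)" by (simp add: z_def algebra_simps)
  have "\<not> r dvd z + 1"
  proof
    assume "r dvd z + 1"
    hence "r dvd 2 * (z + 1)" by (rule dvd_mult)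
    also have "2 * (z + 1) = 2 * z + 2" by simp
    finally have "r dvd 2 * z + 2" .
    moreover have "[2 * z + 2 = w + 2] (mod r)"
      using z by (intro cong_add cong_refl) (rule cong_dvd_modulus_nat, auto)
    ultimately have "r dvd w + 2" by (metis cong_dvd_iff)
    hence "r dvd (w + 2) - (w + 1)" using True dvd_diff_nat by blast
    thus False using r by simp
  qed
  hence "coprime (z + 1) (r ^ e)"
    using r prime_imp_coprime coprime_commute coprime_power_right_iff by blast
  moreover have "[2 * z = w] (mod r ^ e)"
    using z by (rule cong_dvd_modulus_nat) auto
  ultimately show ?thesis using 3 by (intro exI[of _ 2] exI[of _ z]) auto
qed

lemma exists_shifted_product_cong_mult:
  fixes m n w :: nat
  assumes "coprime m n"
    and "\<exists>y z. coprime (y + 1) m \<and> coprime (z + 1) m \<and> [y * z = w] (mod m)"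
    and "\<exists>y z. coprime (y + 1) n \<and> coprime (z + 1) n \<and> [y * z = w] (mod n)"
  shows "\<exists>y z. coprime (y + 1) (m * n) \<and> coprime (z + 1) (m * n) \<and> [y * z = w] (mod m * n)"
proof -
  obtain y1 z1 where 1: "coprime (y1 + 1) m" "coprime (z1 + 1) m" "[y1 * z1 = w] (mod m)"
    using assms(2) by blast
  obtain y2 z2 where 2: "coprime (y2 + 1) n" "coprime (z2 + 1) n" "[y2 * z2 = w] (mod n)"
    using assms(3) by blast
  obtain y where y: "[y = y1] (mod m)" "[y = y2] (mod n)"
    using binary_chinese_remainder_nat assms(1) by blast
  obtain z where z: "[z = z1] (mod m)" "[z = z2] (mod n)"
    using binary_chinese_remainder_nat assms(1) by blast
  have *: "coprime (v + 1) k" if "coprime (u + 1) k" "[v = u] (mod k)" for u v k :: nat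
  proof -
    have "[v + 1 = u + 1] (mod k)" using that(2) by (intro cong_add cong_refl)
    thus ?thesis using that(1) cong_imp_coprime cong_sym by blast
  qed
  have "[y * z = w] (mod m)" "[y * z = w] (mod n)"
    using cong_mult[OF y(1) z(1)] cong_mult[OF y(2) z(2)] 1(3) 2(3) cong_trans by blast+
  hence "[y * z = w] (mod m * n)" using assms(1) coprime_cong_mult_nat by blast
  moreover have "coprime (y + 1) (m * n)" "coprime (z + 1) (m * n)"
    using *[OF 1(1) y(1)] *[OF 2(1) y(2)] *[OF 1(2) z(1)] *[OF 2(2) z(2)]
    by simp_all
  ultimately show ?thesis by blast
qed

text \<open>Away from \<open>p\<close> and \<open>q\<close> the values \<open>p - 1\<close> and
  \<open>q - 1\<close> themselves serve; only the powers of \<open>p\<close> and of \<open>q\<close>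
  in \<open>M\<close> need the local solution.\<close>

lemma exists_shifted_product_cong:
  fixes p q M :: nat
  assumes p: "prime p" "p \<ge> 5" and q: "prime q" "q \<ge> 5" and "p \<noteq> q" and M: "M > 0"
  shows "\<exists>y z. coprime (y + 1) M \<and> coprime (z + 1) M \<and> [y * z = (p - 1) * (q - 1)] (mod M)"
proof -
  obtain e M' where M': "M = p ^ e * M'" "coprime p M'" "M' > 0"
    using prime_power_coprime_decomposition p M by metis
  obtain f R where R: "M' = q ^ f * R" "coprime q R" "R > 0"
    using prime_power_coprime_decomposition q M' by metis
  have pR: "coprime p R" using M'(2) R(1) by simp
  have "\<exists>y z. coprime (y + 1) R \<and> coprime (z + 1) R \<and> [y * z = (p - 1) * (q - 1)] (mod R)"
    using p q pR R by (intro exI[of _ "p - 1"] exI[of _ "q - 1"]) auto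
  hence "\<exists>y z. coprime (y + 1) M' \<and> coprime (z + 1) M' \<and> [y * z = (p - 1) * (q - 1)] (mod M')"
    unfolding R(1) using R(2) exists_shifted_product_cong_prime_power[OF q]
    by (intro exists_shifted_product_cong_mult) auto
  thus ?thesis
    unfolding M'(1) using M'(2) exists_shifted_product_cong_prime_power[OF p]
    by (intro exists_shifted_product_cong_mult) auto
qed

section \<open>Replacing prime factors by large primes\<close>

lemma large_prime_pred_cong:
  fixes y M K :: nat
  assumes "M > 0" "coprime (y + 1) M"
  obtains q where "prime q" "q > K" "[q = y + 1] (mod M)" "[q - 1 = y] (mod M)"
proof -
  obtain q where q: "q > K" "prime q" "[q = y + 1] (mod M)"
    using Dirichlet_primes[OF assms] by (auto simp: infinite_nat_iff_unbounded)
  have "[q - 1 + 1 = y + 1] (mod M)" using q prime_gt_0_nat by simp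
  hence "[q - 1 = y] (mod M)" by (simp only: cong_add_rcancel_nat)
  thus ?thesis using q that by blast
qed

lemma infinite_totients_cong_square_factor:
  fixes b p M :: nat
  assumes M: "M > 0" and b: "b > 0" and p: "prime p" "p ^ 2 dvd b"
  shows "infinite {t. is_totient t \<and> [t = totient b] (mod M)}"
  unfolding infinite_nat_iff_unbounded
proof
  fix K :: nat
  obtain k c where c: "b = p ^ k * c" "coprime p c" "c > 0"
    using prime_power_coprime_decomposition p b by metis
  have "coprime (p ^ 2) c" using c(2) by simp
  hence "p ^ 2 dvd p ^ k" using p(2) c(1) by (simp add: coprime_dvd_mult_left_iff)
  hence k: "k \<ge> 2" using p(1) by (metis dvd_power_iff_le prime_ge_2_nat)
  obtain y where y: "coprime (y + 1) M" "[y * (y + 1) ^ (k - 1) = (p - 1) * p ^ (k - 1)] (mod M)"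
    using exists_shifted_power_cong[OF p(1) _ M, of "k - 1"] k by auto
  \<comment> \<open>Being larger than \<open>c\<close> makes \<open>q\<close> coprime to
    \<open>c\<close>; the rest of the margin gives \<open>q - 1 > K\<close>, so the totient exceeds
    \<open>K\<close>.\<close>
  obtain q where q: "prime q" "q > K + c + 1" "[q = y + 1] (mod M)" "[q - 1 = y] (mod M)"
    using large_prime_pred_cong[OF M y(1)] by metis
  have "coprime q c" using q(1,2) c(3) by (auto intro!: prime_imp_coprime dest: dvd_imp_le)
  hence tot: "totient (q ^ k * c) = (q - 1) * q ^ (k - 1) * totient c"
    using q(1) k totient_mult_coprime[of "q ^ k" c] totient_prime_power[of q k]
    by (simp add: mult.commute)
  have "[(q - 1) * q ^ (k - 1) = y * (y + 1) ^ (k - 1)] (mod M)"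
    using q(3,4) by (intro cong_mult cong_pow)
  hence "[(q - 1) * q ^ (k - 1) * totient c = (p - 1) * p ^ (k - 1) * totient c] (mod M)"
    by (intro cong_mult[OF cong_trans[OF _ y(2)] cong_refl])
  moreover have "totient b = (p - 1) * p ^ (k - 1) * totient c"
    using c p(1) k totient_mult_coprime[of "p ^ k" c] totient_prime_power[of p k]
    by (simp add: mult.commute)
  ultimately have "[totient (q ^ k * c) = totient b] (mod M)" by (simp add: tot)
  moreover have "is_totient (totient (q ^ k * c))"
    unfolding is_totient_def using prime_gt_0_nat[OF q(1)] c(3) by (intro exI[of _ "q ^ k * c"]) auto
  moreover have "q - 1 \<le> totient (q ^ k * c)"
    unfolding tot using c(3) prime_gt_0_nat[OF q(1)] by (simp add: mult.assoc Suc_le_eq)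
  hence "K < totient (q ^ k * c)" using q(2) by simp
  ultimately show "\<exists>n>K. n \<in> {t. is_totient t \<and> [t = totient b] (mod M)}" by blast
qed

lemma infinite_totients_cong_two_primes:
  fixes p q c M :: nat
  assumes M: "M > 0" and p: "prime p" "p \<ge> 5" and q: "prime q" "q \<ge> 5" and "p \<noteq> q"
    and c: "c > 0" "coprime p c" "coprime q c"
  shows "infinite {t. is_totient t \<and> [t = totient (p * q * c)] (mod M)}"
  unfolding infinite_nat_iff_unbounded
proof
  fix K :: nat
  obtain y z where yz: "coprime (y + 1) M" "coprime (z + 1) M" "[y * z = (p - 1) * (q - 1)] (mod M)"
    using exists_shifted_product_cong[OF p q \<open>p \<noteq> q\<close> M] by blast
  obtain p' where p': "prime p'" "p' > K + c + 1" "[p' - 1 = y] (mod M)"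
    using large_prime_pred_cong[OF M yz(1)] by metis
  \<comment> \<open>The margin makes \<open>q'\<close> differ from \<open>p'\<close> and not divide
    \<open>c\<close>.\<close>
  obtain q' where q': "prime q'" "q' > p' + c" "[q' - 1 = z] (mod M)"
    using large_prime_pred_cong[OF M yz(2)] by metis
  have cop: "coprime p' c" "coprime q' c" using p' q' c(1)
    by (auto intro!: prime_imp_coprime dest: dvd_imp_le)
  have "coprime p' q'" using primes_coprime[OF p'(1) q'(1)] q'(2) by linarith
  hence tot: "totient (p' * q' * c) = (p' - 1) * (q' - 1) * totient c"
    using p'(1) q'(1) cop by (simp add: totient_mult_coprime totient_prime)
  have "coprime p q" using p q \<open>p \<noteq> q\<close> primes_coprime by blast
  hence tot0: "totient (p * q * c) = (p - 1) * (q - 1) * totient c"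
    using p q c by (simp add: totient_mult_coprime totient_prime)
  have "[(p' - 1) * (q' - 1) = y * z] (mod M)"
    using p'(3) q'(3) by (intro cong_mult)
  hence "[totient (p' * q' * c) = totient (p * q * c)] (mod M)"
    unfolding tot tot0 by (intro cong_mult[OF cong_trans[OF _ yz(3)] cong_refl])
  moreover have "is_totient (totient (p' * q' * c))"
    unfolding is_totient_def using prime_gt_0_nat[OF p'(1)] prime_gt_0_nat[OF q'(1)] c(1) by (intro exI[of _ "p' * q' * c"]) auto
  moreover have "p' - 1 \<le> totient (p' * q' * c)"
    unfolding tot using c(1) q'(2) p'(2) by (simp add: mult.assoc Suc_le_eq)
  hence "K < totient (p' * q' * c)" using p'(2) by simp
  ultimately show "\<exists>n>K. n \<in> {t. is_totient t \<and> [t = totient (p * q * c)] (mod M)}" by blast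
qed

text \<open>Oddness keeps 4 coprime to the cofactor when it replaces 3, and otherwise leaves only
  primes at least 5; a squarefree composite has two distinct ones.\<close>

lemma infinite_totients_cong_odd:
  fixes b M :: nat
  assumes M: "M > 0" and b: "odd b" "b \<noteq> 1" "\<not> prime b"
  shows "infinite {t. is_totient t \<and> [t = totient b] (mod M)}"
proof (cases "\<exists>p. prime p \<and> p ^ 2 dvd b")
  case True
  thus ?thesis using infinite_totients_cong_square_factor M b by (metis odd_pos)
next
  case sqf: False
  have b0: "b > 0" using b odd_pos by blast
  show ?thesis
  proof (cases "3 dvd b")
    case True
    then obtain c where c: "b = 3 * c" by auto
    \<comment> \<open>Modulo 3 no two shifted units multiply to \<open>-1\<close>, so 3 is traded for 4, as \<open>\<phi>(3) = \<phi>(4)\<close>.\<close>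
    have "\<not> 3 dvd c"
    proof
      assume "3 dvd c"
      hence "3 ^ 2 dvd b" unfolding c power2_eq_square by (rule mult_dvd_mono[OF dvd_refl])
      moreover have "prime (3::nat)" by simp
      ultimately show False using sqf by blast
    qed
    hence "coprime 3 c" by (intro prime_imp_coprime) auto
    hence "totient b = 2 * totient c"
      unfolding c by (simp add: totient_mult_coprime totient_prime)
    moreover have "coprime (2 ^ 2) c" using b(1) c by (simp only: coprime_power_left_iff) simp
    hence "totient (2 ^ 2 * c) = totient (2 ^ 2) * totient c" by (rule totient_mult_coprime)
    hence "totient (2 ^ 2 * c) = 2 * totient c"
      using totient_prime_power[of 2 2] by simp
    ultimately have "totient b = totient (2 ^ 2 * c)" by simp
    moreover have "2 ^ 2 * c > 0" using b0 c by simp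
    ultimately show ?thesis
      using infinite_totients_cong_square_factor[OF M, of "2 ^ 2 * c" 2] by simp
  next
    case False
    obtain p where p: "prime p" "p dvd b" using b(2) prime_factor_nat by blast
    then obtain d where d: "b = p * d" by auto
    have "d \<noteq> 1" using b(3) p d by auto
    then obtain q where q: "prime q" "q dvd d" using prime_factor_nat by blast
    then obtain c where c: "d = q * c" by auto
    have bc: "b = p * q * c" by (simp add: d c)
    have nd: "\<not> r * r dvd b" if "prime r" for r using sqf that by (simp add: power2_eq_square)
    have "p \<noteq> q" using nd[OF p(1)] unfolding bc by auto
    moreover have "\<not> p dvd c"
    proof
      assume "p dvd c"
      hence "p * p dvd p * (q * c)" by (intro mult_dvd_mono dvd_mult) auto
      thus False using nd[OF p(1)] bc by (simp add: mult.assoc)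
    qed
    moreover have "\<not> q dvd c"
    proof
      assume "q dvd c"
      hence "q * q dvd p * (q * c)" by (intro dvd_mult mult_dvd_mono) auto
      thus False using nd[OF q(1)] bc by (simp add: mult.assoc)
    qed
    moreover have ge5: "r \<ge> 5" if "prime r" "r dvd b" for r
    proof -
      have "r \<noteq> 2" "r \<noteq> 3" "r \<noteq> 4" "r \<ge> 2" using that b(1) False prime_ge_2_nat
        by auto
      thus ?thesis by linarith
    qed
    moreover have "q dvd b" using q c bc by simp
    moreover have "c > 0" using b0 bc by simp
    ultimately show ?thesis
      unfolding bc using p q M by (intro infinite_totients_cong_two_primes prime_imp_coprime)
        (auto simp: bc)
  qed
qed

theorem theorem1:
  fixes M s m a b :: nat
  assumes "M = 2 ^ s * m" and "s \<ge> 2" and "m \<ge> 1" and "odd m"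
    and "b > 0" and "a = totient b" and "a > 1"
    and "\<not> prime b"
    and "\<not> (\<exists>p. prime p \<and> odd p \<and> b = 2 * p)"
  shows "infinite {t. is_totient t \<and> [t = a] (mod M)}"
proof -
  have M: "M > 0" using assms(1,3) by simp
  show ?thesis
  proof (cases "odd b")
    case True
    have "b \<noteq> 1" using assms(6,7) by auto
    thus ?thesis using infinite_totients_cong_odd[OF M True] assms(6,8) by simp
  next
    case False
    then obtain c where c: "b = 2 * c" by auto
    show ?thesis
    proof (cases "odd c")
      case True
      have "totient b = totient c" using True unfolding c by (simp add: totient_mult_coprime)
      moreover have "c \<noteq> 1" using assms(6,7) calculation by auto
      \<comment> \<open>This is where \<open>b\<close> not being twice an odd prime enters: it makes
        the odd part \<open>c\<close> composite.\<close>
      moreover have "\<not> prime c" using assms(9) True c by blast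
      ultimately show ?thesis using infinite_totients_cong_odd[OF M True] assms(6) by simp
    next
      case False
      hence "2 ^ 2 dvd b" using c by (simp add: power2_eq_square)
      thus ?thesis
        using infinite_totients_cong_square_factor[OF M assms(5) two_is_prime_nat] assms(6) by simp
    qed
  qed
qed

end
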